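(* The following assertions hold: (1) There is a local Noetherian domain $(R,\mathfrak{m})$ of mixed characteristic such that $R$ is seminormal, but not weakly normal. (2) There is a local Noetherian domain $(R,\mathfrak{m})$ of mixed characteristic such that $R$ is weakly normal and satisfies Serre's $(R_1)$-condition, but is not normal.
   Context: Rings are commutative with unity. For an integral extension $A\subset B$ put $$A_B^+=\Big\{b\in B~\Big|~\tfrac{b}{1}\in A_{\mathfrak p}+J(B_{\mathfrak p})\text{ for all }\mathfrak p\in\operatorname{Spec}(A)\Big\},$$ $$A_B^*=\Big\{b\in B~\Big|~\text{for all }\mathfrak{p}\in\operatorname{Spec}(A)\text{ there is } n\in\mathbb{N}\text{ with }\big(\tfrac{b}{1}\big)^{q^n}\in A_{\mathfrak p}+J(B_{\mathfrak p})\Big\},$$ where $J(-)$ is the Jacobson radical, $B_{\mathfrak p}=B\otimes_A A_{\mathfrak p}$, and $q$ is the characteristic exponent of the field $A_{\mathfrak p}/\mathfrak{p}A_{\mathfrak p}$ ($q=1$ in characteristic $0$, otherwise $q$ is the characteristic). Let $A$ be a reduced Noetherian ring and $B$ its normalization in the total quotient ring. Then $A$ is seminormal if $A_B^+=A$, and weakly normal if $A_B^*=A$. A local domain has mixed characteristic if it has characteristic $0$ and its residue field has positive characteristic. Serre's condition $(R_1)$: $R_{\mathfrak p}$ is regular for every prime $\mathfrak p$ of height at most $1$. *)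

theory Defs
  imports
    "HOL-Algebra.Algebra"
    "HOL-Library.Extended_Nat"
    "HOL-Computational_Algebra.Polynomial"
    "HOL-Computational_Algebra.Fraction_Field"
begin

subsection \<open>Localization\<close>

text \<open>
  In the following definitions \<open>S\<close> is meant to be a multiplicatively closed subset of the
  commutative ring \<open>R\<close>. Zero divisors are allowed in \<open>S\<close>, hence the factor \<open>u\<close>.
\<close>

definition frac_rel :: "('a, 'c) ring_scheme \<Rightarrow> 'a set \<Rightarrow> (('a \<times> 'a) \<times> ('a \<times> 'a)) set" where
  "frac_rel R S = {((a, s), (b, t)). a \<in> carrier R \<and> s \<in> S \<and> b \<in> carrier R \<and> t \<in> S \<and>
     (\<exists>u\<in>S. u \<otimes>\<^bsub>R\<^esub> (a \<otimes>\<^bsub>R\<^esub> t) = u \<otimes>\<^bsub>R\<^esub> (b \<otimes>\<^bsub>R\<^esub> s))}"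

definition fraction :: "('a, 'c) ring_scheme \<Rightarrow> 'a set \<Rightarrow> 'a \<Rightarrow> 'a \<Rightarrow> ('a \<times> 'a) set" where
  "fraction R S a s = frac_rel R S `` {(a, s)}"

text \<open>
  The unions range over all representatives; all members of such a union coincide, since
  the operations on fractions are well defined.
\<close>

definition localization :: "('a, 'c) ring_scheme \<Rightarrow> 'a set \<Rightarrow> ('a \<times> 'a) set ring" where
  "localization R S =
    \<lparr>carrier = {fraction R S a s | a s. a \<in> carrier R \<and> s \<in> S},
     monoid.mult = (\<lambda>x y. \<Union>(a, s)\<in>x. \<Union>(b, t)\<in>y. fraction R S (a \<otimes>\<^bsub>R\<^esub> b) (s \<otimes>\<^bsub>R\<^esub> t)),
     one = fraction R S \<one>\<^bsub>R\<^esub> \<one>\<^bsub>R\<^esub>,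
     ring.zero = fraction R S \<zero>\<^bsub>R\<^esub> \<one>\<^bsub>R\<^esub>,
     add = (\<lambda>x y. \<Union>(a, s)\<in>x. \<Union>(b, t)\<in>y.
              fraction R S ((a \<otimes>\<^bsub>R\<^esub> t) \<oplus>\<^bsub>R\<^esub> (b \<otimes>\<^bsub>R\<^esub> s)) (s \<otimes>\<^bsub>R\<^esub> t))\<rparr>"

definition non_zero_divisors :: "('a, 'c) ring_scheme \<Rightarrow> 'a set" where
  "non_zero_divisors R =
     {s \<in> carrier R. \<forall>a\<in>carrier R. s \<otimes>\<^bsub>R\<^esub> a = \<zero>\<^bsub>R\<^esub> \<longrightarrow> a = \<zero>\<^bsub>R\<^esub>}"

definition total_quotient_ring :: "('a, 'c) ring_scheme \<Rightarrow> ('a \<times> 'a) set ring" where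
  "total_quotient_ring R = localization R (non_zero_divisors R)"

definition total_quotient_image :: "('a, 'c) ring_scheme \<Rightarrow> ('a \<times> 'a) set set" where
  "total_quotient_image R = (\<lambda>a. fraction R (non_zero_divisors R) a \<one>\<^bsub>R\<^esub>) ` carrier R"


subsection \<open>Normalization\<close>

definition integral_closure :: "('a, 'c) ring_scheme \<Rightarrow> 'a set \<Rightarrow> 'a set" where
  "integral_closure R A =
     {b \<in> carrier R. \<exists>f \<in> carrier (A[X]\<^bsub>R\<^esub>). f \<noteq> [] \<and> Polynomials.lead_coeff f = \<one>\<^bsub>R\<^esub> \<and> ring.eval R f b = \<zero>\<^bsub>R\<^esub>}"

definition normalization :: "('a, 'c) ring_scheme \<Rightarrow> ('a \<times> 'a) set ring" where
  "normalization R =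
     (total_quotient_ring R)
       \<lparr>carrier := integral_closure (total_quotient_ring R) (total_quotient_image R)\<rparr>"

text \<open>
  For domains this is the usual notion of normality (integrally closed in the field of fractions).
\<close>

definition is_normal :: "('a, 'c) ring_scheme \<Rightarrow> bool" where
  "is_normal R \<longleftrightarrow> carrier (normalization R) = total_quotient_image R"


subsection \<open>Local rings and characteristic\<close>

definition local_ring :: "('a, 'c) ring_scheme \<Rightarrow> 'a set \<Rightarrow> bool" where
  "local_ring R m \<longleftrightarrow> cring R \<and> maximalideal m R \<and> (\<forall>M. maximalideal M R \<longrightarrow> M = m)"

definition jacobson_radical :: "('a, 'c) ring_scheme \<Rightarrow> 'a set" where
  "jacobson_radical R = carrier R \<inter> \<Inter>{M. maximalideal M R}"

definition ring_characteristic :: "('a, 'c) ring_scheme \<Rightarrow> nat" where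
  "ring_characteristic R =
     (if \<exists>n::nat. n > 0 \<and> [n] \<cdot>\<^bsub>R\<^esub> \<one>\<^bsub>R\<^esub> = \<zero>\<^bsub>R\<^esub>
      then LEAST n::nat. n > 0 \<and> [n] \<cdot>\<^bsub>R\<^esub> \<one>\<^bsub>R\<^esub> = \<zero>\<^bsub>R\<^esub> else 0)"

definition characteristic_exponent :: "('a, 'c) ring_scheme \<Rightarrow> nat" where
  "characteristic_exponent K =
     (if ring_characteristic K = 0 then 1 else ring_characteristic K)"

definition mixed_characteristic :: "('a, 'c) ring_scheme \<Rightarrow> 'a set \<Rightarrow> bool" where
  "mixed_characteristic R m \<longleftrightarrow> ring_characteristic R = 0 \<and> ring_characteristic (R Quot m) > 0"

definition residue_field_at :: "('a, 'c) ring_scheme \<Rightarrow> 'a set \<Rightarrow> ('a \<times> 'a) set set ring" where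
  "residue_field_at R p =
     localization R (carrier R - p) Quot {fraction R (carrier R - p) a s | a s. a \<in> p \<and> s \<in> carrier R - p}"


subsection \<open>Seminormality and weak normality\<close>

text \<open>
  An extension of rings is given by a ring \<open>B\<close> and a subring \<open>A\<close> of \<open>B\<close>. For a prime \<open>p\<close> of \<open>A\<close>,
  \<open>B \<otimes> A\<^sub>p\<close> is the localization of \<open>B\<close> at \<open>A - p\<close>. As localization is exact, \<open>A\<^sub>p\<close> is the subring
  of this ring consisting of the fractions with numerator in \<open>A\<close>.
\<close>

definition local_subring :: "('b, 'c) ring_scheme \<Rightarrow> 'b set \<Rightarrow> 'b set \<Rightarrow> ('b \<times> 'b) set set" where
  "local_subring B A p = {fraction B (A - p) a s | a s. a \<in> A \<and> s \<in> A - p}"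

definition plus_closure :: "('b, 'c) ring_scheme \<Rightarrow> 'b set \<Rightarrow> 'b set" where
  "plus_closure B A =
     {b \<in> carrier B. \<forall>p. primeideal p (B\<lparr>carrier := A\<rparr>) \<longrightarrow>
        (let Bp = localization B (A - p)
         in fraction B (A - p) b \<one>\<^bsub>B\<^esub> \<in> local_subring B A p <+>\<^bsub>Bp\<^esub> jacobson_radical Bp)}"

definition star_closure :: "('b, 'c) ring_scheme \<Rightarrow> 'b set \<Rightarrow> 'b set" where
  "star_closure B A =
     {b \<in> carrier B. \<forall>p. primeideal p (B\<lparr>carrier := A\<rparr>) \<longrightarrow>
        (let Bp = localization B (A - p);
             q = characteristic_exponent (residue_field_at (B\<lparr>carrier := A\<rparr>) p)
         in \<exists>n::nat. fraction B (A - p) b \<one>\<^bsub>B\<^esub> [^]\<^bsub>Bp\<^esub> (q ^ n)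
                     \<in> local_subring B A p <+>\<^bsub>Bp\<^esub> jacobson_radical Bp)}"

text \<open>The next two notions are meant for reduced Noetherian rings.\<close>

definition seminormal :: "('a, 'c) ring_scheme \<Rightarrow> bool" where
  "seminormal R \<longleftrightarrow> plus_closure (normalization R) (total_quotient_image R) = total_quotient_image R"

definition weakly_normal :: "('a, 'c) ring_scheme \<Rightarrow> bool" where
  "weakly_normal R \<longleftrightarrow> star_closure (normalization R) (total_quotient_image R) = total_quotient_image R"


subsection \<open>Regularity\<close>

definition prime_height :: "('a, 'c) ring_scheme \<Rightarrow> 'a set \<Rightarrow> enat" where
  "prime_height R p =
     Sup {enat n | n. \<exists>P :: nat \<Rightarrow> 'a set. (\<forall>i\<le>n. primeideal (P i) R) \<and>
                        (\<forall>i<n. P i \<subset> P (Suc i)) \<and> P n = p}"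

definition krull_dim :: "('a, 'c) ring_scheme \<Rightarrow> enat" where
  "krull_dim R = (SUP p\<in>{p. primeideal p R}. prime_height R p)"

text \<open>
  A Noetherian local ring of dimension \<open>d\<close> is regular if its maximal ideal is generated by \<open>d\<close>
  elements. A generating set with fewer than \<open>d\<close> elements does not exist.
\<close>

definition regular_local_ring :: "('a, 'c) ring_scheme \<Rightarrow> bool" where
  "regular_local_ring R \<longleftrightarrow> noetherian_ring R \<and>
     (\<exists>m. local_ring R m \<and>
        (\<exists>G \<subseteq> carrier R. finite G \<and> enat (card G) = krull_dim R \<and> m = Idl\<^bsub>R\<^esub> G))"

definition serre_R1 :: "('a, 'c) ring_scheme \<Rightarrow> bool" where
  "serre_R1 R \<longleftrightarrow> (\<forall>p. primeideal p R \<and> prime_height R p \<le> 1 \<longrightarrow>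
     regular_local_ring (localization R (carrier R - p)))"

end

theory Submission
  imports Defs "HOL-Computational_Algebra.Polynomial_Factorial"
begin

text \<open>
  Both rings arise by shrinking a localization of \<open>\<int>[X]\<close>. Let \<open>E\<close> be a subring of \<open>\<int>[X]\<close> and \<open>I\<close> an
  ideal of \<open>\<int>[X]\<close> that is contained in \<open>E\<close>, prime in \<open>E\<close>, and contains 2. Localizing at \<open>E - I\<close> gives
  a local ring \<open>A\<close> with maximal ideal \<open>M\<close> and an integral extension \<open>B\<close> of \<open>A\<close>, a localization of
  \<open>\<int>[X]\<close>; here \<open>M\<close> is also an ideal of \<open>B\<close>, so that \<open>A\<close> consists of those elements of \<open>B\<close> whose class
  in \<open>B / M\<close> lies in the subfield \<open>A / M\<close>. As \<open>\<int>[X]\<close> is a UFD, \<open>B\<close> is the normalization of \<open>A\<close>. As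
  \<open>\<int>[X]\<close> is finite over \<open>\<int>[Y]\<close> for a monic \<open>Y\<close> in \<open>E\<close>, the ring \<open>A\<close> is Noetherian.

  In both examples \<open>M\<close> is the Jacobson radical of \<open>B\<close>. At the prime \<open>M\<close> the localizations of \<open>A\<close> and \<open>B\<close>
  are \<open>A\<close> and \<open>B\<close> themselves, hence \<open>b \<in> A + J(B) = A\<close> for every \<open>b\<close> in \<open>A\<^sub>B\<^sup>+\<close>: both rings are
  seminormal. In the same way \<open>A\<^sub>B\<^sup>*\<close> can only contain elements with a \<open>2\<^sup>n\<close>-th power in \<open>A\<close>.

  \<^item> Take \<open>B = \<int>[X]\<close> localized at \<open>(2)\<close>, with residue field \<open>\<FF>\<^sub>2(X)\<close>, and shrink the residue field
    to \<open>\<FF>\<^sub>2(X\<^sup>2)\<close>. This extension of residue fields is purely inseparable, \<open>X\<^sup>2\<close> lies in \<open>A\<close> and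
    \<open>X\<close> does not. At primes containing 2 the exponent is \<open>q = 2\<close>, and at the other primes
    \<open>X = 2X / 2\<close> is a fraction with numerator and denominator in \<open>A\<close>. So \<open>X\<close> lies in \<open>A\<^sub>B\<^sup>*\<close>.

  \<^item> Take \<open>B\<close> semilocal with the maximal ideals \<open>(2, X)\<close> and \<open>(2, X - 1)\<close>, and let \<open>A\<close> consist of the
    elements with equal values in \<open>\<FF>\<^sub>2\<close> at these two points. Since \<open>\<FF>\<^sub>2\<close> is perfect, an element
    with a \<open>2\<^sup>n\<close>-th power in \<open>A\<close> is in \<open>A\<close>, and \<open>A\<close> is weakly normal. It is not normal, because \<open>X\<close>
    separates the points. But \<open>A\<close> and \<open>B\<close> differ only at \<open>M\<close>, which has height 2: a
    nonzero prime of height 1 is cut out by a prime element \<open>q\<close> of \<open>\<int>[X]\<close>, and the localization of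
    \<open>A\<close> there is the discrete valuation ring \<open>\<int>[X]\<close> localized at \<open>(q)\<close>.

  The localizations are rings of classes of pairs, and the localizations of the normalization are
  classes of pairs of such classes. All of them embed into the field \<open>\<rat>(X)\<close>, and each statement is
  carried over to a statement about subsets of \<open>\<rat>(X)\<close>.
\<close>

section \<open>Rings embedded in a field\<close>

text \<open>
  Closure under the operations and the existence of negatives suffice: the ring axioms hold because
  they hold in the field. So no ring structure of a localization is ever checked by hand.
\<close>

locale field_embedding =
  fixes R (structure) and h :: "'a \<Rightarrow> 'k::field"
  assumes inj_value: "inj_on h (carrier R)"
    and one_in: "\<one> \<in> carrier R" and value_one: "h \<one> = 1"
    and zero_in: "\<zero> \<in> carrier R" and value_zero: "h \<zero> = 0"
    and mult_in: "\<lbrakk>x \<in> carrier R; y \<in> carrier R\<rbrakk> \<Longrightarrow> x \<otimes> y \<in> carrier R"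
    and value_mult: "\<lbrakk>x \<in> carrier R; y \<in> carrier R\<rbrakk> \<Longrightarrow> h (x \<otimes> y) = h x * h y"
    and add_in: "\<lbrakk>x \<in> carrier R; y \<in> carrier R\<rbrakk> \<Longrightarrow> x \<oplus> y \<in> carrier R"
    and value_add: "\<lbrakk>x \<in> carrier R; y \<in> carrier R\<rbrakk> \<Longrightarrow> h (x \<oplus> y) = h x + h y"
    and neg_in: "x \<in> carrier R \<Longrightarrow> \<exists>y\<in>carrier R. h y = - h x"
begin

lemma value_eqI: "\<lbrakk>h x = h y; x \<in> carrier R; y \<in> carrier R\<rbrakk> \<Longrightarrow> x = y"
  using inj_value by (auto dest: inj_onD)

lemma domain_of_embedding: "domain R"
proof (rule domainI)
  show "cring R"
  proof (rule cringI)
    show "abelian_group R"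
    proof (rule abelian_groupI)
      fix x assume x: "x \<in> carrier R"
      then obtain y where "y \<in> carrier R" "h y = - h x" using neg_in by blast
      with x have "y \<oplus> x = \<zero>"
        by (intro value_eqI) (simp_all add: value_add add_in zero_in value_zero)
      with \<open>y \<in> carrier R\<close> show "\<exists>y\<in>carrier R. y \<oplus> x = \<zero>" by blast
    qed (auto intro!: value_eqI simp: value_add add_in zero_in value_zero algebra_simps)
    show "comm_monoid R"
      by (rule comm_monoidI)
        (auto intro!: value_eqI simp: value_mult mult_in one_in value_one algebra_simps)
  qed (auto intro!: value_eqI simp: value_mult mult_in value_add add_in algebra_simps)
  show "\<one> \<noteq> \<zero>" using value_one value_zero by auto
  fix a b assume ab: "a \<otimes> b = \<zero>" "a \<in> carrier R" "b \<in> carrier R"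
  then have "h a * h b = h \<zero>" using value_mult by metis
  then have "h a = h \<zero> \<or> h b = h \<zero>" by (simp add: value_zero)
  then show "a = \<zero> \<or> b = \<zero>" using ab zero_in value_eqI by blast
qed

end

sublocale field_embedding \<subseteq> domain R
  by (rule domain_of_embedding)

context field_embedding
begin

lemma value_a_inv: "x \<in> carrier R \<Longrightarrow> h (\<ominus> x) = - h x"
  using value_add[of x "\<ominus> x"] by (simp add: r_neg value_zero eq_neg_iff_add_eq_0 add.commute)

lemma value_eq_zero_iff: "x \<in> carrier R \<Longrightarrow> h x = 0 \<longleftrightarrow> x = \<zero>"
  using value_eqI[of x \<zero>] value_zero by auto

lemma value_nat_pow: "x \<in> carrier R \<Longrightarrow> h (x [^] (n::nat)) = h x ^ n"
  by (induction n) (simp_all add: value_one value_mult)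

text \<open>Subsets of the field are used to describe ideals; a subset closed under addition and under
  multiplication by the image of the ring pulls back to an ideal.\<close>

lemma value_ideal:
  assumes "\<And>x. x \<in> I \<Longrightarrow> x \<in> h ` carrier R" "0 \<in> I" "\<And>x y. \<lbrakk>x \<in> I; y \<in> I\<rbrakk> \<Longrightarrow> x + y \<in> I"
    and "\<And>x y. \<lbrakk>x \<in> I; y \<in> h ` carrier R\<rbrakk> \<Longrightarrow> y * x \<in> I"
  shows "ideal {x \<in> carrier R. h x \<in> I} R"
proof (rule idealI)
  have neg: "- x \<in> I" if "x \<in> I" for x
    using assms(4)[OF that, of "-1"] value_a_inv[OF one_closed] value_one
    by (metis image_eqI mult_minus1 a_inv_closed one_closed)
  show "subgroup {x \<in> carrier R. h x \<in> I} (add_monoid R)"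
    by (rule subgroup.intro)
      (auto simp: value_add value_zero assms value_a_inv neg simp flip: a_inv_def)
  fix a x assume "a \<in> {x \<in> carrier R. h x \<in> I}" "x \<in> carrier R"
  then show "x \<otimes> a \<in> {x \<in> carrier R. h x \<in> I}" "a \<otimes> x \<in> {x \<in> carrier R. h x \<in> I}"
    using assms(4)[of "h a" "h x"] by (auto simp: value_mult mult.commute)
qed (rule ring_axioms)

text \<open>The last premise says that the quotient is a field.\<close>

lemma value_maximalideal:
  assumes I: "ideal {x \<in> carrier R. h x \<in> I} R" and "1 \<notin> I"
    and inv: "\<And>x. \<lbrakk>x \<in> h ` carrier R; x \<notin> I\<rbrakk> \<Longrightarrow> \<exists>y\<in>h ` carrier R. 1 - x * y \<in> I"
  shows "maximalideal {x \<in> carrier R. h x \<in> I} R"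
proof (rule maximalidealI[OF I])
  show "carrier R \<noteq> {x \<in> carrier R. h x \<in> I}"
    using one_closed value_one assms(2) by force
  fix J assume J: "ideal J R" "{x \<in> carrier R. h x \<in> I} \<subseteq> J" "J \<subseteq> carrier R"
  interpret J: ideal J R by fact
  show "J = {x \<in> carrier R. h x \<in> I} \<or> J = carrier R"
  proof (rule disjCI)
    assume "J \<noteq> carrier R"
    show "J = {x \<in> carrier R. h x \<in> I}"
    proof (rule ccontr)
      assume "J \<noteq> {x \<in> carrier R. h x \<in> I}"
      then obtain x where x: "x \<in> J" "x \<in> carrier R" "h x \<notin> I" using J by auto
      then obtain y where y: "y \<in> carrier R" "1 - h x * h y \<in> I" using inv by blast
      define d where "d = \<one> \<oplus> \<ominus> (x \<otimes> y)"
      have "d \<in> J" using J(2) x y 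
        by (auto simp: d_def value_add value_one value_a_inv value_mult)
      moreover have "x \<otimes> y \<in> J" using x y J.I_r_closed by blast
      ultimately have "d \<oplus> x \<otimes> y \<in> J" by simp
      moreover have "d \<oplus> x \<otimes> y = \<one>" using x y by (simp add: d_def a_assoc l_neg)
      ultimately show False using J.one_imp_carrier \<open>J \<noteq> carrier R\<close> by auto
    qed
  qed
qed

end

section \<open>Localizations of embedded rings\<close>

text \<open>The choice of the representative does not matter for the classes that occur.\<close>

definition frac_value :: "('a \<Rightarrow> 'k::field) \<Rightarrow> ('a \<times> 'a) set \<Rightarrow> 'k" where
  "frac_value h x = (let z = SOME z. z \<in> x in h (fst z) / h (snd z))"

lemma Union_of_equal_sets:
  assumes "A \<noteq> {}" "B \<noteq> {}" "\<And>x y. \<lbrakk>x \<in> A; y \<in> B\<rbrakk> \<Longrightarrow> f x y = c"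
  shows "(\<Union>x\<in>A. \<Union>y\<in>B. f x y) = c"
  using assms by auto

locale embedded_localization = field_embedding R h for R (structure) and h +
  fixes S
  assumes S_sub: "S \<subseteq> carrier R" and one_in_S: "\<one> \<in> S" and zero_notin_S: "\<zero> \<notin> S"
    and S_mult: "\<lbrakk>s \<in> S; t \<in> S\<rbrakk> \<Longrightarrow> s \<otimes> t \<in> S"
begin

lemma S_in: "s \<in> S \<Longrightarrow> s \<in> carrier R" using S_sub by auto

lemma value_S: "s \<in> S \<Longrightarrow> h s \<noteq> 0"
  using value_eq_zero_iff S_in zero_notin_S by blast

text \<open>The factor \<open>u\<close> in the equivalence of fractions cancels, as there are no zero divisors.\<close>

lemma fraction_eq:
  assumes "a \<in> carrier R" "s \<in> S"
  shows "fraction R S a s = {(b, t). b \<in> carrier R \<and> t \<in> S \<and> h b / h t = h a / h s}"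
proof -
  have "(\<exists>u\<in>S. u \<otimes> (a \<otimes> t) = u \<otimes> (b \<otimes> s)) \<longleftrightarrow> h b / h t = h a / h s"
    if "b \<in> carrier R" "t \<in> S" for b t
  proof
    assume "\<exists>u\<in>S. u \<otimes> (a \<otimes> t) = u \<otimes> (b \<otimes> s)"
    then obtain u where u: "u \<in> S" "u \<otimes> (a \<otimes> t) = u \<otimes> (b \<otimes> s)" by blast
    then have "h u * (h a * h t) = h u * (h b * h s)"
      using that assms S_in by (metis value_mult m_closed)
    then show "h b / h t = h a / h s"
      using value_S u that assms by (simp add: field_simps)
  next
    assume "h b / h t = h a / h s"
    then have "a \<otimes> t = b \<otimes> s"
      using that assms by (intro value_eqI) (auto simp: value_mult S_in value_S field_simps)
    then show "\<exists>u\<in>S. u \<otimes> (a \<otimes> t) = u \<otimes> (b \<otimes> s)" using one_in_S by auto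
  qed
  then show ?thesis
    using assms by (auto simp: fraction_def frac_rel_def)
qed

lemma frac_value_fraction:
  assumes "a \<in> carrier R" "s \<in> S"
  shows "frac_value h (fraction R S a s) = h a / h s"
proof -
  have "(a, s) \<in> fraction R S a s" using assms by (simp add: fraction_eq)
  then have "(SOME z. z \<in> fraction R S a s) \<in> fraction R S a s" by (rule someI)
  then show ?thesis using assms by (auto simp: frac_value_def fraction_eq Let_def)
qed

lemma fraction_cases:
  assumes "x \<in> carrier (localization R S)"
  obtains a s where "a \<in> carrier R" "s \<in> S" "x = fraction R S a s"
  using assms by (auto simp: localization_def)

lemma fraction_in [simp]:
  "\<lbrakk>a \<in> carrier R; s \<in> S\<rbrakk> \<Longrightarrow> fraction R S a s \<in> carrier (localization R S)"
  by (auto simp: localization_def)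

lemma fraction_eqI:
  "\<lbrakk>a \<in> carrier R; s \<in> S; b \<in> carrier R; t \<in> S; h a / h s = h b / h t\<rbrakk>
    \<Longrightarrow> fraction R S a s = fraction R S b t"
  by (simp add: fraction_eq)

text \<open>All members of the union that defines the product of two fractions coincide.\<close>

lemma fraction_mult:
  assumes "a \<in> carrier R" "s \<in> S" "b \<in> carrier R" "t \<in> S"
  shows "fraction R S a s \<otimes>\<^bsub>localization R S\<^esub> fraction R S b t = fraction R S (a \<otimes> b) (s \<otimes> t)"
proof -
  have same: "fraction R S (a' \<otimes> b') (s' \<otimes> t') = fraction R S (a \<otimes> b) (s \<otimes> t)"
    if "(a', s') \<in> fraction R S a s" "(b', t') \<in> fraction R S b t" for a' s' b' t'
  proof (rule fraction_eqI)
    from that assms have in': "a' \<in> carrier R" "s' \<in> S" "b' \<in> carrier R" "t' \<in> S"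
      and eq: "h a' / h s' = h a / h s" "h b' / h t' = h b / h t"
      by (simp_all add: fraction_eq)
    from in' show "a' \<otimes> b' \<in> carrier R" "s' \<otimes> t' \<in> S" by (simp_all add: S_mult)
    have "h (a' \<otimes> b') / h (s' \<otimes> t') = (h a' / h s') * (h b' / h t')"
      using in' S_in by (simp add: value_mult)
    also have "\<dots> = h (a \<otimes> b) / h (s \<otimes> t)"
      unfolding eq using assms S_in by (simp add: value_mult)
    finally show "h (a' \<otimes> b') / h (s' \<otimes> t') = h (a \<otimes> b) / h (s \<otimes> t)" .
  qed (use assms in \<open>simp_all add: S_mult\<close>)
  have mem: "(a, s) \<in> fraction R S a s" "(b, t) \<in> fraction R S b t"
    using assms by (auto simp: fraction_eq)
  have "(\<Union>z\<in>fraction R S a s. \<Union>w\<in>fraction R S b t.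
      case z of (a', s') \<Rightarrow> case w of (b', t') \<Rightarrow> fraction R S (a' \<otimes> b') (s' \<otimes> t')) = fraction R S (a \<otimes> b) (s \<otimes> t)"
  proof (rule Union_of_equal_sets)
    show "fraction R S a s \<noteq> {}" "fraction R S b t \<noteq> {}" using mem by blast+
  qed (simp add: same split_beta)
  then show ?thesis by (simp add: localization_def case_prod_unfold)
qed

lemma fraction_add:
  assumes "a \<in> carrier R" "s \<in> S" "b \<in> carrier R" "t \<in> S"
  shows "fraction R S a s \<oplus>\<^bsub>localization R S\<^esub> fraction R S b t
       = fraction R S (a \<otimes> t \<oplus> b \<otimes> s) (s \<otimes> t)"
proof -
  have *: "h (a' \<otimes> t' \<oplus> b' \<otimes> s') / h (s' \<otimes> t') = h a' / h s' + h b' / h t'"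
    if "a' \<in> carrier R" "s' \<in> S" "b' \<in> carrier R" "t' \<in> S" for a' b' s' t'
    using that value_S S_in by (simp add: value_add value_mult field_simps)
  have same: "fraction R S (a' \<otimes> t' \<oplus> b' \<otimes> s') (s' \<otimes> t') = fraction R S (a \<otimes> t \<oplus> b \<otimes> s) (s \<otimes> t)"
    if "(a', s') \<in> fraction R S a s" "(b', t') \<in> fraction R S b t" for a' s' b' t'
  proof (rule fraction_eqI)
    from that assms have in': "a' \<in> carrier R" "s' \<in> S" "b' \<in> carrier R" "t' \<in> S"
      and eq: "h a' / h s' = h a / h s" "h b' / h t' = h b / h t"
      by (simp_all add: fraction_eq)
    from in' show "a' \<otimes> t' \<oplus> b' \<otimes> s' \<in> carrier R" "s' \<otimes> t' \<in> S"
      by (simp_all add: S_mult S_in)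
    show "h (a' \<otimes> t' \<oplus> b' \<otimes> s') / h (s' \<otimes> t') = h (a \<otimes> t \<oplus> b \<otimes> s) / h (s \<otimes> t)"
      unfolding *[OF in'] *[OF assms] eq ..
  qed (use assms in \<open>simp_all add: S_mult S_in\<close>)
  have mem: "(a, s) \<in> fraction R S a s" "(b, t) \<in> fraction R S b t"
    using assms by (auto simp: fraction_eq)
  have "(\<Union>z\<in>fraction R S a s. \<Union>w\<in>fraction R S b t.
      case z of (a', s') \<Rightarrow> case w of (b', t') \<Rightarrow> fraction R S (a' \<otimes> t' \<oplus> b' \<otimes> s') (s' \<otimes> t')) = fraction R S (a \<otimes> t \<oplus> b \<otimes> s) (s \<otimes> t)"
  proof (rule Union_of_equal_sets)
    show "fraction R S a s \<noteq> {}" "fraction R S b t \<noteq> {}" using mem by blast+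
  qed (simp add: same split_beta)
  then show ?thesis by (simp add: localization_def case_prod_unfold)
qed

lemma localization_embedding: "field_embedding (localization R S) (frac_value h)"
proof
  show "inj_on (frac_value h) (carrier (localization R S))"
  proof (rule inj_onI)
    fix x y assume "x \<in> carrier (localization R S)" "y \<in> carrier (localization R S)"
      and eq: "frac_value h x = frac_value h y"
    then obtain a s b t where *: "a \<in> carrier R" "s \<in> S" "x = fraction R S a s"
        "b \<in> carrier R" "t \<in> S" "y = fraction R S b t"
      by (elim fraction_cases)
    with eq have "h a / h s = h b / h t" by (simp add: frac_value_fraction)
    with * show "x = y" by (simp add: fraction_eq)
  qed
  have one: "\<one>\<^bsub>localization R S\<^esub> = fraction R S \<one> \<one>" 
    and zero: "\<zero>\<^bsub>localization R S\<^esub> = fraction R S \<zero> \<one>"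
    by (simp_all add: localization_def)
  show "\<one>\<^bsub>localization R S\<^esub> \<in> carrier (localization R S)"
    "frac_value h \<one>\<^bsub>localization R S\<^esub> = 1"
    "\<zero>\<^bsub>localization R S\<^esub> \<in> carrier (localization R S)"
    "frac_value h \<zero>\<^bsub>localization R S\<^esub> = 0"
    using one_in_S by (simp_all add: one zero frac_value_fraction value_zero value_one)
  fix x assume "x \<in> carrier (localization R S)"
  then obtain a s where a: "a \<in> carrier R" "s \<in> S" and x: "x = fraction R S a s"
    by (rule fraction_cases)
  show "\<exists>y\<in>carrier (localization R S). frac_value h y = - frac_value h x"
    using a by (intro bexI[of _ "fraction R S (\<ominus> a) s"])
      (auto simp: x frac_value_fraction value_a_inv)
  fix y assume "y \<in> carrier (localization R S)"
  then obtain b t where b: "b \<in> carrier R" "t \<in> S" and y: "y = fraction R S b t"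
    by (rule fraction_cases)
  show "x \<otimes>\<^bsub>localization R S\<^esub> y \<in> carrier (localization R S)"
    "frac_value h (x \<otimes>\<^bsub>localization R S\<^esub> y) = frac_value h x * frac_value h y"
    "x \<oplus>\<^bsub>localization R S\<^esub> y \<in> carrier (localization R S)"
    "frac_value h (x \<oplus>\<^bsub>localization R S\<^esub> y) = frac_value h x + frac_value h y"
    using a b value_S S_in
    by (simp_all add: x y fraction_mult fraction_add frac_value_fraction S_mult 
        value_mult value_add field_simps)
qed

lemma localization_values:
  "frac_value h ` carrier (localization R S) = {h a / h s | a s. a \<in> carrier R \<and> s \<in> S}"
proof (intro subset_antisym subsetI)
  fix x assume "x \<in> frac_value h ` carrier (localization R S)"
  then show "x \<in> {h a / h s | a s. a \<in> carrier R \<and> s \<in> S}"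
    using frac_value_fraction by (fastforce elim: fraction_cases)
next
  fix x assume "x \<in> {h a / h s | a s. a \<in> carrier R \<and> s \<in> S}"
  then obtain a s where "a \<in> carrier R" "s \<in> S" "x = h a / h s" by blast
  then show "x \<in> frac_value h ` carrier (localization R S)"
    by (intro image_eqI[of _ _ "fraction R S a s"]) (simp_all add: frac_value_fraction)
qed

end

section \<open>Subrings of a field\<close>

definition unital_subring :: "'k::field set \<Rightarrow> bool" where
  "unital_subring C \<longleftrightarrow> 0 \<in> C \<and> 1 \<in> C \<and> (\<forall>x\<in>C. \<forall>y\<in>C. x + y \<in> C \<and> x * y \<in> C) \<and> (\<forall>x\<in>C. - x \<in> C)"

definition ring_on :: "'k::field set \<Rightarrow> 'k ring" where
  "ring_on A = \<lparr>carrier = A, monoid.mult = (*), one = 1, ring.zero = 0, add = (+)\<rparr>"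

lemma ring_on_simps [simp]:
  "carrier (ring_on A) = A" "x \<otimes>\<^bsub>ring_on A\<^esub> y = x * y" "x \<oplus>\<^bsub>ring_on A\<^esub> y = x + y"
  "\<one>\<^bsub>ring_on A\<^esub> = 1" "\<zero>\<^bsub>ring_on A\<^esub> = 0"
  by (simp_all add: ring_on_def)

lemma ring_on_embedding: "unital_subring A \<Longrightarrow> field_embedding (ring_on A) (\<lambda>x. x)"
  by unfold_locales (auto simp: unital_subring_def)

lemma (in field_embedding) subring_embedding:
  assumes "unital_subring C" "C \<subseteq> h ` carrier R"
  shows "field_embedding (R\<lparr>carrier := {x \<in> carrier R. h x \<in> C}\<rparr>) h"
proof
  show "inj_on h (carrier (R\<lparr>carrier := {x \<in> carrier R. h x \<in> C}\<rparr>))"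
    using inj_value by (auto intro: inj_on_subset)
  fix x assume x: "x \<in> carrier (R\<lparr>carrier := {x \<in> carrier R. h x \<in> C}\<rparr>)"
  then show "\<exists>y\<in>carrier (R\<lparr>carrier := {x \<in> carrier R. h x \<in> C}\<rparr>). h y = - h x"
    using assms(1) by (intro bexI[of _ "\<ominus> x"]) (auto simp: value_a_inv unital_subring_def)
qed (use assms(1) in \<open>auto simp: unital_subring_def value_one value_zero value_add value_mult\<close>)

text \<open>
  Maximal ideals of a subring of a field, with maximality expressed by inverses modulo \<open>J\<close>.
  In this form maximality passes to every ring that embeds with image \<open>C\<close>.
\<close>

definition maximal_in :: "'k::field set \<Rightarrow> 'k set \<Rightarrow> bool" where
  "maximal_in C J \<longleftrightarrow> J \<subseteq> C \<and> 0 \<in> J \<and> 1 \<notin> J \<and> (\<forall>x\<in>J. \<forall>y\<in>J. x + y \<in> J) \<and>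
     (\<forall>x\<in>J. \<forall>y\<in>C. y * x \<in> J) \<and> (\<forall>x\<in>C. x \<notin> J \<longrightarrow> (\<exists>y\<in>C. 1 - x * y \<in> J))"

lemma (in field_embedding) maximal_in_pullback:
  assumes "maximal_in (h ` carrier R) J"
  shows "maximalideal {x \<in> carrier R. h x \<in> J} R"
proof (rule value_maximalideal)
  show "ideal {x \<in> carrier R. h x \<in> J} R"
    using assms unfolding maximal_in_def by (intro value_ideal) blast+
qed (use assms[unfolded maximal_in_def] in blast)+

lemma (in field_embedding) non_zero_divisors_eq: "non_zero_divisors R = carrier R - {\<zero>}"
  using integral by (fastforce simp: non_zero_divisors_def)

lemma (in field_embedding) total_quotient_localization:
  "embedded_localization R h (non_zero_divisors R)"
  by unfold_locales (auto simp: non_zero_divisors_eq integral_iff)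

lemma (in field_embedding) prime_complement_localization:
  assumes "primeideal P (R\<lparr>carrier := A\<rparr>)" "A \<subseteq> carrier R" "\<one> \<in> A"
  shows "embedded_localization R h (A - P)"
proof -
  interpret P: primeideal P "R\<lparr>carrier := A\<rparr>" by fact
  have "\<one> \<notin> P" using P.one_imp_carrier P.I_notcarr by auto
  moreover have "s \<otimes> t \<in> A - P" if "s \<in> A - P" "t \<in> A - P" for s t
    using that P.I_prime[of s t] P.m_closed[of s t] by auto
  moreover have "\<zero> \<in> P" using additive_subgroup.zero_closed[OF ideal.axioms(1)[OF P.is_ideal]] by simp
  ultimately show ?thesis
    using assms by unfold_locales auto
qed

lemma Fract_power: "Fract f g ^ n = Fract (f ^ n) (g ^ n)"
  by (induction n) (simp_all add: fract_collapse)

section \<open>Gluing along an ideal of \<open>\<int>[X]\<close>\<close>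

text \<open>
  The ideal \<open>I\<close> of \<open>\<int>[X]\<close> is prime in the subring \<open>E\<close>, so that \<open>E - I\<close> is a set of
  denominators. The assumption \<open>quadratic\<close> makes \<open>\<int>[X]\<close> integral over \<open>E\<close>. By the assumption
  \<open>monic\<close>, \<open>\<int>[X]\<close> is finite over a polynomial ring \<open>\<int>[Y]\<close> inside \<open>E\<close>, from which the Noetherian
  property follows. As 2 lies in \<open>I\<close>, the residue field of \<open>A\<close> has characteristic 2.
\<close>

locale conductor_square =
  fixes E I :: "int poly set"
  assumes E_one: "1 \<in> E" and E_add: "\<lbrakk>f \<in> E; g \<in> E\<rbrakk> \<Longrightarrow> f + g \<in> E"
    and E_mult: "\<lbrakk>f \<in> E; g \<in> E\<rbrakk> \<Longrightarrow> f * g \<in> E" and E_uminus: "f \<in> E \<Longrightarrow> - f \<in> E"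
    and I_sub: "I \<subseteq> E" and I_add: "\<lbrakk>f \<in> I; g \<in> I\<rbrakk> \<Longrightarrow> f + g \<in> I"
    and I_mult: "f \<in> I \<Longrightarrow> g * f \<in> I" and one_notin_I: "1 \<notin> I"
    and I_prime: "\<lbrakk>f \<in> E; g \<in> E; f * g \<in> I\<rbrakk> \<Longrightarrow> f \<in> I \<or> g \<in> I"
    and two_in_I: "2 \<in> I"
    and quadratic: "\<exists>r\<in>E. f * f - r * f \<in> E"
    and monic: "\<exists>Y\<in>E. Polynomial.lead_coeff Y = 1 \<and> Polynomial.degree Y > 0"
begin

definition A :: "int poly fract set" where "A = {Fract f g | f g. f \<in> E \<and> g \<in> E - I}"
definition B :: "int poly fract set" where "B = {Fract f g | f g. g \<in> E - I}"
definition M :: "int poly fract set" where "M = {Fract f g | f g. f \<in> I \<and> g \<in> E - I}"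

lemma zero_in_I: "0 \<in> I" using I_mult[OF two_in_I, of 0] by simp

lemma denominator_nonzero: "g \<in> E - I \<Longrightarrow> g \<noteq> 0" using zero_in_I by auto

lemma denominator_mult: "\<lbrakk>f \<in> E - I; g \<in> E - I\<rbrakk> \<Longrightarrow> f * g \<in> E - I"
  using E_mult I_prime by blast

lemma denominator_one: "1 \<in> E - I" using E_one one_notin_I by simp

lemma mem_A: "\<lbrakk>f \<in> E; g \<in> E; g \<notin> I\<rbrakk> \<Longrightarrow> Fract f g \<in> A" by (auto simp: A_def)
lemma mem_B: "\<lbrakk>g \<in> E; g \<notin> I\<rbrakk> \<Longrightarrow> Fract f g \<in> B" by (auto simp: B_def)
lemma mem_M: "\<lbrakk>f \<in> I; g \<in> E; g \<notin> I\<rbrakk> \<Longrightarrow> Fract f g \<in> M" by (auto simp: M_def)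

lemma A_cases:
  assumes "x \<in> A" obtains f g where "f \<in> E" "g \<in> E" "g \<notin> I" "g \<noteq> 0" "x = Fract f g"
  using assms zero_in_I unfolding A_def by blast
lemma B_cases:
  assumes "x \<in> B" obtains f g where "g \<in> E" "g \<notin> I" "g \<noteq> 0" "x = Fract f g"
  using assms zero_in_I unfolding B_def by blast
lemma M_cases:
  assumes "x \<in> M" obtains f g where "f \<in> I" "g \<in> E" "g \<notin> I" "g \<noteq> 0" "x = Fract f g"
  using assms zero_in_I unfolding M_def by blast

lemma subring_A: "unital_subring A"
  unfolding unital_subring_def
proof (intro conjI ballI)
  show "0 \<in> A" "1 \<in> A"
    using mem_A[of 0 1] mem_A[of 1 1] denominator_one zero_in_I I_sub
    by (auto simp: fract_collapse)
  fix x assume "x \<in> A"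
  then obtain f g where x: "f \<in> E" "g \<in> E" "g \<notin> I" "g \<noteq> 0" "x = Fract f g" by (rule A_cases)
  then show "- x \<in> A" by (simp add: mem_A E_uminus)
  fix y assume "y \<in> A"
  then obtain f' g' where "f' \<in> E" "g' \<in> E" "g' \<notin> I" "g' \<noteq> 0" "y = Fract f' g'" by (rule A_cases)
  with x show "x + y \<in> A" "x * y \<in> A"
    using denominator_mult[of g g'] by (auto intro!: mem_A E_add E_mult)
qed

lemma subring_B: "unital_subring B"
  unfolding unital_subring_def
proof (intro conjI ballI)
  show "0 \<in> B" "1 \<in> B"
    using mem_B[of 1 0] mem_B[of 1 1] denominator_one by (auto simp: fract_collapse)
  fix x assume "x \<in> B"
  then obtain f g where x: "g \<in> E" "g \<notin> I" "g \<noteq> 0" "x = Fract f g" by (rule B_cases)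
  then show "- x \<in> B" by (simp add: mem_B)
  fix y assume "y \<in> B"
  then obtain f' g' where "g' \<in> E" "g' \<notin> I" "g' \<noteq> 0" "y = Fract f' g'" by (rule B_cases)
  with x show "x + y \<in> B" "x * y \<in> B"
    using denominator_mult[of g g'] by (auto intro!: mem_B E_mult)
qed

lemma A_sub_B: "A \<subseteq> B" by (auto simp: A_def B_def)
lemma M_sub_A: "M \<subseteq> A" using I_sub by (auto simp: A_def M_def)

lemma zero_in_M: "0 \<in> M"
  using mem_M[of 0 1] zero_in_I denominator_one by (auto simp: fract_collapse)

lemma M_add: "\<lbrakk>x \<in> M; y \<in> M\<rbrakk> \<Longrightarrow> x + y \<in> M"
proof -
  assume "x \<in> M" "y \<in> M"
  then obtain f g f' g' where *: "f \<in> I" "g \<in> E" "g \<notin> I" "g \<noteq> 0" "x = Fract f g"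
    "f' \<in> I" "g' \<in> E" "g' \<notin> I" "g' \<noteq> 0" "y = Fract f' g'"
    by (elim M_cases)
  then have "f * g' + f' * g \<in> I"
    using I_mult[of f g'] I_mult[of f' g] I_add by (simp add: mult.commute)
  with * show "x + y \<in> M" using denominator_mult[of g g'] by (auto intro: mem_M)
qed

lemma M_mult: "\<lbrakk>x \<in> M; y \<in> B\<rbrakk> \<Longrightarrow> y * x \<in> M"
  using denominator_mult I_mult
  by (auto elim!: M_cases B_cases intro!: mem_M E_mult)

lemma one_notin_M: "1 \<notin> M"
proof
  assume "1 \<in> M"
  then obtain f g where f: "f \<in> I" "g \<in> E" "g \<notin> I" "g \<noteq> 0" "1 = Fract f g" by (rule M_cases)
  then have "f = g" by (simp add: One_fract_def eq_fract)
  with f show False by simp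
qed

text \<open>Numerators outside \<open>I\<close> are themselves denominators; this makes \<open>A\<close> local.\<close>

lemma unit_A: "\<lbrakk>x \<in> A; x \<notin> M\<rbrakk> \<Longrightarrow> x \<noteq> 0 \<and> inverse x \<in> A"
  using zero_in_M by (auto elim!: A_cases intro!: mem_A intro: mem_M)

lemma two_in_M: "2 \<in> M"
proof -
  have "(2 :: int poly fract) = Fract 2 1"
    using of_nat_fract[of 2, where ?'a = "int poly"] by simp
  then show ?thesis using mem_M[OF two_in_I, of 1] denominator_one by auto
qed

sublocale A: field_embedding "ring_on A" "\<lambda>x. x"
  by (rule ring_on_embedding[OF subring_A])

lemma maximal_in_A: "maximal_in A M"
  unfolding maximal_in_def
proof (intro conjI ballI impI M_sub_A zero_in_M one_notin_M)
  fix x assume "x \<in> M"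
  show "y * x \<in> M" if "y \<in> A" for y using that \<open>x \<in> M\<close> M_mult A_sub_B by blast
  show "x + y \<in> M" if "y \<in> M" for y using that \<open>x \<in> M\<close> M_add by blast
next
  fix x assume "x \<in> A" "x \<notin> M"
  then have "x \<noteq> 0" "inverse x \<in> A" using unit_A by blast+
  then show "\<exists>y\<in>A. 1 - x * y \<in> M" using zero_in_M by (intro bexI[of _ "inverse x"]) simp_all
qed

lemma maximal_M: "maximalideal M (ring_on A)"
proof -
  have "{x \<in> carrier (ring_on A). x \<in> M} = M" using M_sub_A by auto
  then show ?thesis using A.maximal_in_pullback[of M] maximal_in_A by simp
qed

lemma local_ring_A: "local_ring (ring_on A) M"
  unfolding local_ring_def
proof (intro conjI allI impI)
  show "cring (ring_on A)" by (rule A.is_cring)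
  show "maximalideal M (ring_on A)" by (rule maximal_M)
  fix J assume "maximalideal J (ring_on A)"
  then interpret J: maximalideal J "ring_on A" .
  have "x \<in> M" if "x \<in> J" for x
  proof (rule ccontr)
    assume "x \<notin> M"
    moreover have "x \<in> A" using that J.Icarr by auto
    ultimately have x: "x \<noteq> 0" "inverse x \<in> A" using unit_A by auto
    then have "x * inverse x \<in> J" using J.I_r_closed[OF that, of "inverse x"] by simp
    with x show False using J.one_imp_carrier J.I_notcarr by simp
  qed
  then show "J = M"
    using J.I_maximal[OF maximalideal.axioms(1)[OF maximal_M]] maximalideal.I_notcarr[OF maximal_M]
      M_sub_A by auto
qed

end

section \<open>The normalization\<close>

context conductor_square
begin

abbreviation "T \<equiv> total_quotient_ring (ring_on A)"
abbreviation "N \<equiv> normalization (ring_on A)"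
abbreviation "A' \<equiv> total_quotient_image (ring_on A)"
abbreviation v :: "(int poly fract \<times> int poly fract) set \<Rightarrow> int poly fract"
  where "v \<equiv> frac_value (\<lambda>x. x)"

sublocale TL: embedded_localization "ring_on A" "\<lambda>x. x" "non_zero_divisors (ring_on A)"
  by (rule A.total_quotient_localization)

sublocale T: field_embedding T v
  unfolding total_quotient_ring_def by (rule TL.localization_embedding)

text \<open>
  The total quotient ring is all of \<open>\<rat>(X)\<close>: since \<open>2f\<close> and \<open>2g\<close> lie in \<open>I\<close>, the fraction
  \<open>f / g = 2f / 2g\<close> is a quotient of two elements of \<open>A\<close>.
\<close>

lemma T_values: "v ` carrier T = UNIV"
proof -
  have "x \<in> v ` carrier T" for x
  proof -
    obtain f g where x: "x = Fract f g" "g \<noteq> 0" by (cases x) auto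
    have "Fract (f * 2) 1 \<in> A" "Fract (g * 2) 1 \<in> A"
      using I_mult[OF two_in_I] I_sub denominator_one by (auto intro!: mem_A)
    moreover have "Fract (g * 2) 1 \<noteq> 0" using x by (simp add: Zero_fract_def eq_fract)
    moreover have "x = Fract (f * 2) 1 / Fract (g * 2) 1"
      using x by (simp add: eq_fract)
    ultimately show ?thesis
      unfolding total_quotient_ring_def TL.localization_values
      by (intro CollectI exI conjI) (auto simp: A.non_zero_divisors_eq)
  qed
  then show ?thesis by auto
qed

lemma T_value_exists: obtains y where "y \<in> carrier T" "v y = x"
  using T_values by (metis UNIV_I imageE)

lemma A'_eq: "A' = {x \<in> carrier T. v x \<in> A}"
proof (intro subset_antisym subsetI)
  have one: "1 \<in> non_zero_divisors (ring_on A)"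
    using TL.one_in_S by simp
  show "x \<in> {x \<in> carrier T. v x \<in> A}" if "x \<in> A'" for x
    using that TL.frac_value_fraction[OF _ one] TL.fraction_in[OF _ one]
    by (auto simp: total_quotient_image_def total_quotient_ring_def)
  fix x assume x: "x \<in> {x \<in> carrier T. v x \<in> A}"
  then have "x = fraction (ring_on A) (non_zero_divisors (ring_on A)) (v x) 1"
    using TL.frac_value_fraction[OF _ one] TL.fraction_in[OF _ one]
    by (intro T.value_eqI) (auto simp: total_quotient_ring_def)
  with x show "x \<in> A'" by (auto simp: total_quotient_image_def)
qed

text \<open>
  Clearing denominators in the terms of an integral equation other than the leading one. For
  \<open>x = f / g\<close> the \<open>n\<close> terms of degree less than \<open>n\<close>, multiplied by \<open>g\<^sup>n\<close>, leave a factor \<open>g\<close>.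
\<close>

lemma eval_denominator:
  assumes "set p \<subseteq> A'" "x \<in> carrier T" "v x = Fract f g" "g \<noteq> 0"
  shows "\<exists>s r. s \<in> E - I \<and> v (T.eval p x) = Fract (g * r) (s * g ^ length p)"
  using assms(1)
proof (induction p)
  case Nil
  then show ?case using denominator_one
    by (intro exI[of _ 1] exI[of _ 0]) (auto simp: T.value_zero fract_collapse)
next
  case (Cons c p)
  then obtain s r where s: "s \<in> E - I" "v (T.eval p x) = Fract (g * r) (s * g ^ length p)" by auto
  from Cons.prems have c: "c \<in> carrier T" "v c \<in> A" and p: "set p \<subseteq> carrier T"
    by (auto simp: A'_eq)
  from c obtain a b where ab: "a \<in> E" "b \<in> E" "b \<notin> I" "b \<noteq> 0" "v c = Fract a b" by (elim A_cases)
  have "s \<noteq> 0" using s denominator_nonzero by blast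
  have "v (T.eval (c # p) x) = v c * v x ^ length p + v (T.eval p x)"
    using c p assms(2) by (simp add: T.value_add T.value_mult T.value_nat_pow T.eval_in_carrier)
  also have "\<dots> = Fract (g * (a * f ^ length p * s + r * b * g)) ((b * s) * g ^ length (c # p))"
    using \<open>s \<noteq> 0\<close> \<open>b \<noteq> 0\<close> \<open>g \<noteq> 0\<close> by (simp add: ab s assms Fract_power eq_fract) (simp add: algebra_simps)
  finally show ?case using ab s denominator_mult[of b s] by blast
qed

text \<open>
  The rational root argument, up to a denominator \<open>s\<close>. For \<open>f / g\<close> in lowest terms,
  an integral equation shows that \<open>g\<close> divides \<open>s\<close> times a power of \<open>f\<close>. Hence \<open>g\<close> divides \<open>s\<close>, and
  \<open>f / g\<close> can be written with the denominator \<open>s\<close>.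
\<close>

lemma integral_imp_B:
  assumes "x \<in> integral_closure T A'"
  shows "v x \<in> B"
proof -
  from assms obtain p where x: "x \<in> carrier T" and p: "p \<in> carrier (A'[X]\<^bsub>T\<^esub>)" "p \<noteq> []"
     "Polynomials.lead_coeff p = \<one>\<^bsub>T\<^esub>" "T.eval p x = \<zero>\<^bsub>T\<^esub>"
    unfolding integral_closure_def by blast
  obtain q where q: "p = \<one>\<^bsub>T\<^esub> # q" using p by (cases p) auto
  have "set q \<subseteq> A'" using p q by (auto simp: univ_poly_def polynomial_def)
  obtain f g where fg: "v x = Fract f g" "g \<noteq> 0" "coprime f g"
    using Fract_quot_of_fract[of "v x"] coprime_quot_of_fract[of "v x"] snd_quot_of_fract_nonzero[of "v x"]
    by metis
  obtain s r where s: "s \<in> E - I" "v (T.eval q x) = Fract (g * r) (s * g ^ length q)"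
    using eval_denominator[OF \<open>set q \<subseteq> A'\<close> x fg(1,2)] by blast
  have "s \<noteq> 0" using s denominator_nonzero by blast
  have "set q \<subseteq> carrier T" using \<open>set q \<subseteq> A'\<close> by (auto simp: A'_eq)
  then have ev: "T.eval q x \<in> carrier T" using x by (rule T.eval_in_carrier)
  have "v (T.eval p x) = v x ^ length q + v (T.eval q x)"
    using x ev by (simp add: q T.value_add T.value_nat_pow)
  also have "\<dots> = Fract ((f ^ length q * s + g * r) * g ^ length q) (s * g ^ length q * g ^ length q)"
    using \<open>s \<noteq> 0\<close> fg(2) by (simp add: fg s Fract_power) (simp add: algebra_simps)
  finally have "Fract ((f ^ length q * s + g * r) * g ^ length q) (s * g ^ length q * g ^ length q) = 0"
    by (simp add: p(4) T.value_zero)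
  then have "f ^ length q * s + g * r = 0" 
    using \<open>s \<noteq> 0\<close> fg(2) by (simp add: Zero_fract_def eq_fract)
  then have "f ^ length q * s = g * (- r)" by (simp add: eq_neg_iff_add_eq_0)
  then have "g dvd f ^ length q * s" by simp
  then have "g dvd s" using fg(3) by (simp add: coprime_commute coprime_dvd_mult_right_iff coprime_power_right_iff)
  then obtain t where "s = g * t" by blast
  then have "v x = Fract (f * t) s" using \<open>s \<noteq> 0\<close> fg by (simp add: eq_fract)
  then show ?thesis using s mem_B by auto
qed

lemma B_imp_integral:
  assumes "x \<in> carrier T" "v x \<in> B"
  shows "x \<in> integral_closure T A'"
proof -
  from assms(2) obtain f g where g: "g \<in> E" "g \<notin> I" "g \<noteq> 0" "v x = Fract f g" by (rule B_cases)
  obtain r where r: "r \<in> E" "f * f - r * f \<in> E" using quadratic by blast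
  obtain c where c: "c \<in> carrier T" "v c = - Fract r g" by (rule T_value_exists)
  obtain e where e: "e \<in> carrier T" "v e = - Fract (f * f - r * f) (g * g)" by (rule T_value_exists)
  have "v c \<in> A" using c(2) g r by (simp add: mem_A E_uminus)
  moreover have "v e \<in> A"
    using e(2) g r E_uminus[OF r(2)] denominator_mult[of g g] by (simp add: mem_A)
  moreover have "v \<one>\<^bsub>T\<^esub> \<in> A" using A.one_closed by (simp add: T.value_one)
  ultimately have "c \<in> A'" "e \<in> A'" "\<one>\<^bsub>T\<^esub> \<in> A'" using c(1) e(1) by (simp_all add: A'_eq)
  then have "[\<one>\<^bsub>T\<^esub>, c, e] \<in> carrier (A'[X]\<^bsub>T\<^esub>)"
    by (simp add: univ_poly_def polynomial_def)
  moreover have "T.eval [\<one>\<^bsub>T\<^esub>, c, e] x = \<zero>\<^bsub>T\<^esub>"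
  proof (rule T.value_eqI)
    have "v (T.eval [\<one>\<^bsub>T\<^esub>, c, e] x) = v x * v x + v c * v x + v e"
      using assms c e
      by (simp add: T.value_add T.value_mult T.value_one T.value_zero T.value_nat_pow numeral_2_eq_2)
    also have "\<dots> = 0"
      using g by (simp add: c e Zero_fract_def eq_fract) (simp add: algebra_simps)
    finally show "v (T.eval [\<one>\<^bsub>T\<^esub>, c, e] x) = v \<zero>\<^bsub>T\<^esub>" by (simp add: T.value_zero)
  qed (use assms c e in \<open>simp_all del: T.eval.simps add: T.eval_in_carrier\<close>)
  ultimately show ?thesis
    using assms(1) unfolding integral_closure_def
    by (intro CollectI conjI bexI[of _ "[\<one>\<^bsub>T\<^esub>, c, e]"]) simp_all
qed

lemma N_carrier: "carrier N = {x \<in> carrier T. v x \<in> B}"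
  using integral_imp_B B_imp_integral
  by (auto simp: normalization_def integral_closure_def)

lemma N_eq: "N = T\<lparr>carrier := {x \<in> carrier T. v x \<in> B}\<rparr>"
  using N_carrier by (simp add: normalization_def)

sublocale N: field_embedding N v
  unfolding N_eq using T_values by (intro T.subring_embedding subring_B) auto

lemma A'_N: "A' = {x \<in> carrier N. v x \<in> A}"
  using A_sub_B by (auto simp: A'_eq N_carrier)

lemma N_values: "v ` carrier N = B"
proof (intro subset_antisym subsetI)
  fix x assume "x \<in> B"
  moreover obtain y where "y \<in> carrier T" "v y = x" by (rule T_value_exists)
  ultimately show "x \<in> v ` carrier N" by (intro image_eqI[of _ _ y]) (simp_all add: N_carrier)
qed (auto simp: N_carrier)

sublocale NA: field_embedding "N\<lparr>carrier := A'\<rparr>" v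
  unfolding A'_N using A_sub_B by (intro N.subring_embedding subring_A) (simp add: N_values)

lemma A'_values: "v ` A' = A"
proof (intro subset_antisym subsetI)
  fix x assume "x \<in> A"
  moreover obtain y where "y \<in> carrier T" "v y = x" by (rule T_value_exists)
  ultimately show "x \<in> v ` A'" by (intro image_eqI[of _ _ y]) (simp_all add: A'_eq)
qed (auto simp: A'_eq)

lemma is_normal_iff: "is_normal (ring_on A) \<longleftrightarrow> A = B"
proof
  assume "is_normal (ring_on A)"
  then have "carrier N = A'" by (simp only: is_normal_def)
  then have "v ` carrier N = v ` A'" by (rule arg_cong)
  then show "A = B" by (simp only: N_values A'_values)
next
  assume "A = B"
  then show "is_normal (ring_on A)" unfolding is_normal_def N_carrier A'_eq by simp
qed

end

section \<open>Residue characteristic\<close>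

lemma ring_characteristic_quotient:
  assumes "ideal I R" "\<one>\<^bsub>R\<^esub> \<notin> I" "\<one>\<^bsub>R\<^esub> \<oplus>\<^bsub>R\<^esub> \<one>\<^bsub>R\<^esub> \<in> I"
  shows "ring_characteristic (R Quot I) = 2"
proof -
  interpret I: ideal I R by fact
  let ?Q = "R Quot I"
  interpret Q: ring ?Q by (rule I.quotient_is_ring)
  have coset_zero: "I +>\<^bsub>R\<^esub> a = I \<longleftrightarrow> a \<in> I" if "a \<in> carrier R" for a
    using I.rcos_const_imp_mem I.a_rcos_zero[OF I.is_ideal] that by blast
  have zero: "\<zero>\<^bsub>?Q\<^esub> = I" and one: "\<one>\<^bsub>?Q\<^esub> = I +>\<^bsub>R\<^esub> \<one>\<^bsub>R\<^esub>" by (simp_all add: FactRing_def)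
  have 1: "add_pow ?Q (1::nat) \<one>\<^bsub>?Q\<^esub> \<noteq> \<zero>\<^bsub>?Q\<^esub>"
    using assms(2) coset_zero Q.add.nat_pow_eone[OF Q.one_closed] by (simp add: zero one)
  have "add_pow ?Q (2::nat) \<one>\<^bsub>?Q\<^esub> = \<one>\<^bsub>?Q\<^esub> \<oplus>\<^bsub>?Q\<^esub> \<one>\<^bsub>?Q\<^esub>"
    using Q.add.nat_pow_Suc[of 1 "\<one>\<^bsub>?Q\<^esub>"] by (simp add: numeral_2_eq_2)
  also have "\<dots> = I +>\<^bsub>R\<^esub> (\<one>\<^bsub>R\<^esub> \<oplus>\<^bsub>R\<^esub> \<one>\<^bsub>R\<^esub>)"
    unfolding one using I.a_rcos_sum by (simp add: FactRing_def)
  also have "\<dots> = \<zero>\<^bsub>?Q\<^esub>" using assms(3) coset_zero by (simp add: zero)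
  finally have 2: "add_pow ?Q (2::nat) \<one>\<^bsub>?Q\<^esub> = \<zero>\<^bsub>?Q\<^esub>" .
  have "(LEAST n::nat. n > 0 \<and> add_pow ?Q n \<one>\<^bsub>?Q\<^esub> = \<zero>\<^bsub>?Q\<^esub>) = 2"
  proof (rule Least_equality)
    fix n :: nat assume n: "n > 0 \<and> add_pow ?Q n \<one>\<^bsub>?Q\<^esub> = \<zero>\<^bsub>?Q\<^esub>"
    with 1 have "n \<noteq> 1" by blast
    with n show "2 \<le> n" by linarith
  qed (use 2 in simp)
  then show ?thesis
    unfolding ring_characteristic_def using 2 by (auto intro: exI[of _ "2::nat"])
qed

context field_embedding
begin

text \<open>
  The ideal by which \<open>residue_field_at\<close> divides is the pullback of the set \<open>W\<close> of fractions with
  numerator in the prime. It contains \<open>1 + 1\<close> and not 1.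
\<close>

lemma residue_characteristic:
  assumes P: "primeideal P R" and two: "\<one> \<oplus> \<one> \<in> P"
  shows "characteristic_exponent (residue_field_at R P) = 2"
proof -
  interpret P: primeideal P R by fact
  let ?S = "carrier R - P"
  interpret L: embedded_localization R h ?S
  proof -
    have "R\<lparr>carrier := carrier R\<rparr> = R" by simp
    then show "embedded_localization R h ?S"
      using prime_complement_localization[of P "carrier R"] P one_closed by simp
  qed
  let ?L = "localization R ?S"
  let ?I = "{fraction R ?S a s | a s. a \<in> P \<and> s \<in> ?S}"
  interpret LE: field_embedding ?L "frac_value h" by (rule L.localization_embedding)
  define W where "W = {h a / h s | a s. a \<in> P \<and> s \<in> ?S}"
  have I: "?I = {x \<in> carrier ?L. frac_value h x \<in> W}"
  proof (intro subset_antisym subsetI)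
    fix x assume "x \<in> ?I"
    then obtain a s where "a \<in> P" "s \<in> ?S" "x = fraction R ?S a s" by blast
    then show "x \<in> {x \<in> carrier ?L. frac_value h x \<in> W}"
      using P.Icarr[of a] by (auto simp: W_def L.frac_value_fraction)
  next
    fix x assume "x \<in> {x \<in> carrier ?L. frac_value h x \<in> W}"
    then obtain a s where x: "x \<in> carrier ?L" "a \<in> P" "s \<in> ?S" "frac_value h x = h a / h s"
      by (auto simp: W_def)
    then have "x = fraction R ?S a s"
      using P.Icarr[of a] by (intro LE.value_eqI) (simp_all add: L.frac_value_fraction)
    with x show "x \<in> ?I" by blast
  qed
  have "ideal ?I ?L" unfolding I
  proof (rule LE.value_ideal)
    show "x \<in> frac_value h ` carrier ?L" if "x \<in> W" for x
      using that P.Icarr unfolding W_def L.localization_values by blast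
    have "\<zero> \<in> P" using additive_subgroup.zero_closed[OF ideal.axioms(1)[OF P.is_ideal]] .
    then show "0 \<in> W" unfolding W_def using L.one_in_S value_zero by force
    show "x + y \<in> W" if xy: "x \<in> W" "y \<in> W" for x y
    proof -
      obtain a s b t where *: "a \<in> P" "s \<in> ?S" "x = h a / h s" "b \<in> P" "t \<in> ?S" "y = h b / h t"
        using xy unfolding W_def by blast
      then have c: "a \<in> carrier R" "b \<in> carrier R" using P.Icarr by blast+
      have "x + y = h (a \<otimes> t \<oplus> b \<otimes> s) / h (s \<otimes> t)"
        using * c L.value_S by (simp add: value_add value_mult field_simps)
      moreover have "a \<otimes> t \<oplus> b \<otimes> s \<in> P"
        using * additive_subgroup.a_closed[OF ideal.axioms(1)[OF P.is_ideal]] by (simp add: P.I_r_closed)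
      ultimately show ?thesis using L.S_mult *(2,5) unfolding W_def by blast
    qed
    show "y * x \<in> W" if xy: "x \<in> W" "y \<in> frac_value h ` carrier ?L" for x y
    proof -
      obtain a s b t where *: "a \<in> P" "s \<in> ?S" "x = h a / h s" "b \<in> carrier R" "t \<in> ?S" "y = h b / h t"
        using xy unfolding W_def L.localization_values by blast
      then have c: "a \<in> carrier R" using P.Icarr by blast
      have "y * x = h (b \<otimes> a) / h (t \<otimes> s)"
        using * c by (simp add: value_mult)
      moreover have "b \<otimes> a \<in> P" using * by (simp add: P.I_l_closed)
      ultimately show ?thesis using L.S_mult *(2,5) unfolding W_def by blast
    qed
  qed
  moreover have "\<one>\<^bsub>?L\<^esub> \<notin> ?I"
  proof
    assume "\<one>\<^bsub>?L\<^esub> \<in> ?I"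
    then have "1 \<in> W" unfolding I by (simp add: LE.value_one)
    then obtain a s where *: "a \<in> P" "s \<in> ?S" "1 = h a / h s" unfolding W_def by blast
    then have "h a = h s" using L.value_S by simp
    then have "a = s" using * P.Icarr by (intro value_eqI) auto
    with * show False by simp
  qed
  moreover have "\<one>\<^bsub>?L\<^esub> \<oplus>\<^bsub>?L\<^esub> \<one>\<^bsub>?L\<^esub> \<in> ?I"
  proof -
    have "frac_value h (\<one>\<^bsub>?L\<^esub> \<oplus>\<^bsub>?L\<^esub> \<one>\<^bsub>?L\<^esub>) = h (\<one> \<oplus> \<one>) / h \<one>"
      by (simp add: LE.value_add LE.value_one value_add value_one)
    then show ?thesis unfolding I W_def using two L.one_in_S by auto
  qed
  ultimately have "ring_characteristic (?L Quot ?I) = 2" by (rule ring_characteristic_quotient)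
  then show ?thesis by (simp add: characteristic_exponent_def residue_field_at_def)
qed

end

context conductor_square
begin

lemma mixed_characteristic_A: "mixed_characteristic (ring_on A) M"
proof -
  have "ring_characteristic (ring_on A Quot M) = 2"
    using one_notin_M two_in_M 
    by (intro ring_characteristic_quotient maximalideal.axioms(1)[OF maximal_M]) simp_all
  moreover have pow: "add_pow (ring_on A) n 1 = of_nat n" for n :: nat
  proof (induction n)
    case (Suc n)
    then show ?case using A.add.nat_pow_Suc[of n 1] by simp
  qed (use A.add.nat_pow_0[of 1] in simp)
  have "of_nat n \<noteq> (0 :: int poly fract)" if "n > 0" for n
    using that by (simp add: of_nat_fract Zero_fract_def eq_fract)
  then have "ring_characteristic (ring_on A) = 0"
    unfolding ring_characteristic_def by (auto simp: pow)
  ultimately show ?thesis by (simp add: mixed_characteristic_def)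
qed

end

section \<open>Seminormality and weak normality\<close>

context conductor_square
begin

lemma A'_sub_N: "A' \<subseteq> carrier N" using A'_N by auto

lemma one_A': "\<one>\<^bsub>N\<^esub> \<in> A'"
  using N.one_closed A.one_closed by (simp add: A'_N N.value_one)

lemma localization_at_prime:
  "primeideal P (N\<lparr>carrier := A'\<rparr>) \<Longrightarrow> embedded_localization N v (A' - P)"
  using N.prime_complement_localization A'_sub_N one_A' by blast

definition M' where "M' = {x \<in> A'. v x \<in> M}"

lemma prime_M': "primeideal M' (N\<lparr>carrier := A'\<rparr>)"
proof -
  have "maximalideal {x \<in> carrier (N\<lparr>carrier := A'\<rparr>). v x \<in> M} (N\<lparr>carrier := A'\<rparr>)"
    by (rule NA.maximal_in_pullback) (simp add: A'_values maximal_in_A)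
  then show ?thesis using NA.maximalideal_prime by (simp add: M'_def)
qed

lemma in_local_subring_plus_radical:
  assumes P: "primeideal P (N\<lparr>carrier := A'\<rparr>)" and a: "a \<in> A'" "s \<in> A' - P"
  shows "fraction N (A' - P) a s \<in> local_subring N A' P
    <+>\<^bsub>localization N (A' - P)\<^esub> jacobson_radical (localization N (A' - P))"
proof -
  interpret L: embedded_localization N v "A' - P" by (rule localization_at_prime[OF P])
  let ?L = "localization N (A' - P)"
  interpret LE: field_embedding ?L "frac_value v" by (rule L.localization_embedding)
  have "\<zero>\<^bsub>?L\<^esub> \<in> jacobson_radical ?L"
    unfolding jacobson_radical_def
    using additive_subgroup.zero_closed[OF ideal.axioms(1)[OF maximalideal.axioms(1)]] by auto
  moreover have "fraction N (A' - P) a s \<in> local_subring N A' P"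
    using a unfolding local_subring_def by blast
  moreover have "fraction N (A' - P) a s \<in> carrier ?L"
    using a A'_sub_N by (intro L.fraction_in) auto
  ultimately show ?thesis
    unfolding set_add_def' by (force simp del: L.fraction_in)
qed

text \<open>
  At the maximal ideal the localizations of \<open>A\<close> and \<open>B\<close> have the images \<open>A\<close> and \<open>B\<close>, because the
  denominators are units of \<open>A\<close>. The assumption says that the Jacobson radical of \<open>B\<close> lies in
  \<open>M\<close>, hence in \<open>A\<close>; so nothing is gained by adding it to \<open>A\<close>.
\<close>

lemma value_local_subring_plus_radical:
  assumes radical: "\<And>x. \<lbrakk>x \<in> B; x \<notin> M\<rbrakk> \<Longrightarrow> \<exists>J. maximal_in B J \<and> x \<notin> J"
    and y: "y \<in> local_subring N A' M'
      <+>\<^bsub>localization N (A' - M')\<^esub> jacobson_radical (localization N (A' - M'))"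
  shows "frac_value v y \<in> A"
proof -
  interpret L: embedded_localization N v "A' - M'"
    by (rule localization_at_prime[OF prime_M'])
  let ?L = "localization N (A' - M')"
  interpret LE: field_embedding ?L "frac_value v" by (rule L.localization_embedding)
  have unit: "v s \<noteq> 0 \<and> inverse (v s) \<in> A" if "s \<in> A' - M'" for s
    using that unit_A[of "v s"] by (simp add: M'_def A'_N)
  have B_mult: "x * z \<in> B" if "x \<in> B" "z \<in> B" for x z
    using that subring_B by (simp add: unital_subring_def)
  have A_mult: "x * z \<in> A" if "x \<in> A" "z \<in> A" for x z
    using that subring_A by (simp add: unital_subring_def)
  have range_L: "frac_value v ` carrier ?L = B"
    unfolding L.localization_values
  proof (intro subset_antisym subsetI)
    fix x assume "x \<in> {v a / v s | a s. a \<in> carrier N \<and> s \<in> A' - M'}"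
    then obtain a s where "a \<in> carrier N" "s \<in> A' - M'" "x = v a / v s" by blast
    moreover from this have "v a \<in> B" using N_values by blast
    moreover have "inverse (v s) \<in> B" using unit[OF \<open>s \<in> A' - M'\<close>] A_sub_B by blast
    ultimately show "x \<in> B" using B_mult by (simp add: divide_inverse)
  next
    fix x assume "x \<in> B"
    then have "x \<in> v ` carrier N" by (simp only: N_values)
    then obtain a where "x = v a" "a \<in> carrier N" by (rule imageE)
    then have "x = v a / v \<one>\<^bsub>N\<^esub> \<and> a \<in> carrier N \<and> \<one>\<^bsub>N\<^esub> \<in> A' - M'"
      by (intro conjI L.one_in_S) (simp_all only: N.value_one div_by_1)
    then show "x \<in> {v a / v s | a s. a \<in> carrier N \<and> s \<in> A' - M'}" by blast
  qed
  from y obtain l j where l: "l \<in> local_subring N A' M'" and j: "j \<in> jacobson_radical ?L"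
    and y_eq: "y = l \<oplus>\<^bsub>?L\<^esub> j"
    unfolding set_add_def' by blast
  from l obtain a s where a: "a \<in> A'" "s \<in> A' - M'" "l = fraction N (A' - M') a s"
    unfolding local_subring_def by blast
  have aN: "a \<in> carrier N" and va: "v a \<in> A" using a by (auto simp: A'_N)
  have l_in: "l \<in> carrier ?L" using a aN by simp
  have "frac_value v l = v a * inverse (v s)"
    using a aN by (simp add: L.frac_value_fraction divide_inverse)
  then have vl: "frac_value v l \<in> A" using A_mult[OF va] unit[OF a(2)] by simp
  have j_in: "j \<in> carrier ?L" using j by (simp add: jacobson_radical_def)
  have "frac_value v j \<in> M"
  proof (rule ccontr)
    assume "frac_value v j \<notin> M"
    moreover have "frac_value v j \<in> B" using j_in range_L by blast
    ultimately obtain J where J: "maximal_in B J" "frac_value v j \<notin> J"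
      using radical by blast
    have "maximalideal {x \<in> carrier ?L. frac_value v x \<in> J} ?L"
      by (rule LE.maximal_in_pullback) (simp add: range_L J)
    then show False using j J(2) by (auto simp: jacobson_radical_def)
  qed
  then have "frac_value v j \<in> A" using M_sub_A by blast
  then show ?thesis
    using vl l_in j_in subring_A by (simp add: y_eq LE.value_add unital_subring_def)
qed

lemma characteristic_exponent_two:
  assumes "primeideal P (N\<lparr>carrier := A'\<rparr>)" "\<one>\<^bsub>N\<^esub> \<oplus>\<^bsub>N\<^esub> \<one>\<^bsub>N\<^esub> \<in> P"
  shows "characteristic_exponent (residue_field_at (N\<lparr>carrier := A'\<rparr>) P) = 2"
  using NA.residue_characteristic[OF assms(1)] assms(2) by simp

lemma value_two: "v (\<one>\<^bsub>N\<^esub> \<oplus>\<^bsub>N\<^esub> \<one>\<^bsub>N\<^esub>) = 2"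
  by (simp add: N.value_add N.value_one)

lemma two_in_A': "\<one>\<^bsub>N\<^esub> \<oplus>\<^bsub>N\<^esub> \<one>\<^bsub>N\<^esub> \<in> A'"
  using two_in_M M_sub_A value_two by (auto simp: A'_N)

lemma A'_sub_plus_closure: "A' \<subseteq> plus_closure N A'"
proof
  fix b assume b: "b \<in> A'"
  have "fraction N (A' - P) b \<one>\<^bsub>N\<^esub> \<in> local_subring N A' P
      <+>\<^bsub>localization N (A' - P)\<^esub> jacobson_radical (localization N (A' - P))"
    if P: "primeideal P (N\<lparr>carrier := A'\<rparr>)" for P
    using in_local_subring_plus_radical[OF P b] embedded_localization.one_in_S[OF localization_at_prime[OF P]] .
  then show "b \<in> plus_closure N A'"
    using b A'_sub_N by (auto simp: plus_closure_def Let_def)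
qed

text \<open>The exponent \<open>q\<^sup>0 = 1\<close> is allowed at every prime.\<close>

lemma plus_closure_sub_star_closure: "plus_closure N A' \<subseteq> star_closure N A'"
proof
  fix b assume b: "b \<in> plus_closure N A'"
  then have bN: "b \<in> carrier N" by (simp add: plus_closure_def)
  show "b \<in> star_closure N A'"
    unfolding star_closure_def Let_def
  proof (intro CollectI conjI allI impI bN)
    fix P assume P: "primeideal P (N\<lparr>carrier := A'\<rparr>)"
    interpret L: embedded_localization N v "A' - P" by (rule localization_at_prime[OF P])
    let ?L = "localization N (A' - P)"
    let ?q = "characteristic_exponent (residue_field_at (N\<lparr>carrier := A'\<rparr>) P)"
    interpret LE: field_embedding ?L "frac_value v" by (rule L.localization_embedding)
    have "fraction N (A' - P) b \<one>\<^bsub>N\<^esub> [^]\<^bsub>?L\<^esub> (?q ^ 0) = fraction N (A' - P) b \<one>\<^bsub>N\<^esub>"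
      using bN L.one_in_S by simp
    then show "\<exists>n::nat. fraction N (A' - P) b \<one>\<^bsub>N\<^esub> [^]\<^bsub>?L\<^esub> (?q ^ n)
        \<in> local_subring N A' P <+>\<^bsub>?L\<^esub> jacobson_radical ?L"
      using b P by (intro exI[of _ 0]) (simp add: plus_closure_def Let_def)
  qed
qed

context
  assumes radical: "\<And>x. \<lbrakk>x \<in> B; x \<notin> M\<rbrakk> \<Longrightarrow> \<exists>J. maximal_in B J \<and> x \<notin> J"
begin

lemma seminormal_A: "seminormal (ring_on A)"
  unfolding seminormal_def
proof (intro subset_antisym A'_sub_plus_closure subsetI)
  fix b assume b: "b \<in> plus_closure N A'"
  then have bN: "b \<in> carrier N" by (simp add: plus_closure_def)
  interpret L: embedded_localization N v "A' - M'" by (rule localization_at_prime[OF prime_M'])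
  have "frac_value v (fraction N (A' - M') b \<one>\<^bsub>N\<^esub>) \<in> A"
    using b prime_M' by (intro value_local_subring_plus_radical radical)
      (auto simp: plus_closure_def Let_def)
  then have "v b \<in> A" using bN L.one_in_S by (simp add: L.frac_value_fraction N.value_one)
  with bN show "b \<in> A'" by (simp add: A'_N)
qed

text \<open>The maximal ideal contains 2, so only powers with exponent \<open>2\<^sup>n\<close> have to be considered there.\<close>

lemma weakly_normal_A:
  assumes root: "\<And>b n. \<lbrakk>b \<in> B; b ^ (2 ^ n) \<in> A\<rbrakk> \<Longrightarrow> b \<in> A"
  shows "weakly_normal (ring_on A)"
  unfolding weakly_normal_def
proof (intro subset_antisym subsetI)
  show "b \<in> star_closure N A'" if "b \<in> A'" for b
    using that A'_sub_plus_closure plus_closure_sub_star_closure by blast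
  fix b assume b: "b \<in> star_closure N A'"
  then have bN: "b \<in> carrier N" by (simp add: star_closure_def)
  interpret L: embedded_localization N v "A' - M'" by (rule localization_at_prime[OF prime_M'])
  let ?L = "localization N (A' - M')"
  interpret LE: field_embedding ?L "frac_value v" by (rule L.localization_embedding)
  have "\<one>\<^bsub>N\<^esub> \<oplus>\<^bsub>N\<^esub> \<one>\<^bsub>N\<^esub> \<in> M'" using two_in_A' two_in_M value_two by (simp add: M'_def)
  then have q: "characteristic_exponent (residue_field_at (N\<lparr>carrier := A'\<rparr>) M') = 2"
    by (rule characteristic_exponent_two[OF prime_M'])
  obtain n :: nat where "fraction N (A' - M') b \<one>\<^bsub>N\<^esub> [^]\<^bsub>?L\<^esub> ((2::nat) ^ n)
      \<in> local_subring N A' M' <+>\<^bsub>?L\<^esub> jacobson_radical ?L"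
    using b prime_M' unfolding star_closure_def Let_def by (auto simp: q)
  then have "frac_value v (fraction N (A' - M') b \<one>\<^bsub>N\<^esub> [^]\<^bsub>?L\<^esub> ((2::nat) ^ n)) \<in> A"
    by (intro value_local_subring_plus_radical radical)
  then have "v b ^ 2 ^ n \<in> A"
    using bN L.one_in_S by (simp add: LE.value_nat_pow L.frac_value_fraction N.value_one)
  then have "v b \<in> A" using root bN by (simp add: N_carrier)
  with bN show "b \<in> A'" by (simp add: A'_N)
qed

end

text \<open>
  The square of \<open>b\<close> is used at primes that contain 2. At all other primes \<open>b = 2b / 2\<close> is in the
  localization of \<open>A\<close>, because \<open>2b\<close> lies in \<open>M\<close>. So the primes need not be known.
\<close>

lemma not_weakly_normal_A:
  assumes b: "b \<in> B" "b \<notin> A" "b ^ 2 \<in> A"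
  shows "\<not> weakly_normal (ring_on A)"
proof -
  have "b \<in> v ` carrier N" using b by (simp only: N_values)
  then obtain x where x: "x \<in> carrier N" "v x = b" by blast
  have "x \<in> star_closure N A'"
    unfolding star_closure_def Let_def
  proof (intro CollectI conjI allI impI x)
    fix P assume P: "primeideal P (N\<lparr>carrier := A'\<rparr>)"
    interpret L: embedded_localization N v "A' - P" by (rule localization_at_prime[OF P])
    let ?L = "localization N (A' - P)"
    let ?q = "characteristic_exponent (residue_field_at (N\<lparr>carrier := A'\<rparr>) P)"
    let ?x = "fraction N (A' - P) x \<one>\<^bsub>N\<^esub>"
    interpret LE: field_embedding ?L "frac_value v" by (rule L.localization_embedding)
    define two where "two = \<one>\<^bsub>N\<^esub> \<oplus>\<^bsub>N\<^esub> \<one>\<^bsub>N\<^esub>"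
    have twoN: "two \<in> carrier N" and twoA: "two \<in> A'" and v2: "v two = 2"
      using two_in_A' value_two by (simp_all add: two_def)
    have xL: "?x \<in> carrier ?L" using x L.one_in_S by simp
    show "\<exists>n::nat. ?x [^]\<^bsub>?L\<^esub> (?q ^ n) \<in> local_subring N A' P <+>\<^bsub>?L\<^esub> jacobson_radical ?L"
    proof (cases "two \<in> P")
      case True
      then have q: "?q = 2" using characteristic_exponent_two[OF P] by (simp add: two_def)
      have x2: "x \<otimes>\<^bsub>N\<^esub> x \<in> A'"
        using b x by (simp add: A'_N N.value_mult power2_eq_square)
      have "?x [^]\<^bsub>?L\<^esub> (2::nat) = fraction N (A' - P) (x \<otimes>\<^bsub>N\<^esub> x) \<one>\<^bsub>N\<^esub>"
      proof (rule LE.value_eqI)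
        show "frac_value v (?x [^]\<^bsub>?L\<^esub> (2::nat)) = frac_value v (fraction N (A' - P) (x \<otimes>\<^bsub>N\<^esub> x) \<one>\<^bsub>N\<^esub>)"
          using x xL L.one_in_S
          by (simp add: LE.value_nat_pow L.frac_value_fraction N.value_one N.value_mult power2_eq_square)
      qed (use x xL L.one_in_S in simp_all)
      then have "?x [^]\<^bsub>?L\<^esub> (?q ^ 1) \<in> local_subring N A' P <+>\<^bsub>?L\<^esub> jacobson_radical ?L"
        using in_local_subring_plus_radical[OF P x2 L.one_in_S] by (simp add: q)
      then show ?thesis by blast
    next
      case False
      have "2 * b \<in> M" using M_mult[OF two_in_M b(1)] by (simp add: mult.commute)
      then have x2: "two \<otimes>\<^bsub>N\<^esub> x \<in> A'"
        using x M_sub_A twoN by (auto simp: A'_N N.value_mult v2)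
      have "?x = fraction N (A' - P) (two \<otimes>\<^bsub>N\<^esub> x) two"
        using False x twoN twoA v2 L.one_in_S
        by (intro L.fraction_eqI) (auto simp: N.value_mult N.value_one)
      then have "?x [^]\<^bsub>?L\<^esub> (?q ^ 0) \<in> local_subring N A' P <+>\<^bsub>?L\<^esub> jacobson_radical ?L"
        using in_local_subring_plus_radical[OF P x2, of two] False twoA xL by simp
      then show ?thesis by blast
    qed
  qed
  moreover have "x \<notin> A'" using b x by (simp add: A'_N)
  ultimately show ?thesis unfolding weakly_normal_def by blast
qed

end

section \<open>The Noetherian property\<close>

lemma of_int_mult_closed:
  fixes U :: "'a::ring_1 set"
  assumes zero: "0 \<in> U" and diff: "\<And>x y. \<lbrakk>x \<in> U; y \<in> U\<rbrakk> \<Longrightarrow> x - y \<in> U" and x: "x \<in> U"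
  shows "of_int k * x \<in> U"
proof (induction k rule: int_induct[of _ 0])
  case (step1 i)
  have "of_int i * x - (0 - x) \<in> U" using step1 zero x by (intro diff)
  then show ?case by (simp add: algebra_simps)
next
  case (step2 i)
  have "of_int i * x - x \<in> U" using step2 x by (intro diff)
  then show ?case by (simp add: algebra_simps)
qed (use zero in simp)

lemma int_subgroup_principal:
  fixes U :: "int set"
  assumes zero: "0 \<in> U" and diff: "\<And>x y. \<lbrakk>x \<in> U; y \<in> U\<rbrakk> \<Longrightarrow> x - y \<in> U"
  shows "\<exists>e\<in>U. \<forall>c\<in>U. e dvd c"
proof (cases "\<exists>n::nat. n > 0 \<and> int n \<in> U")
  case False
  have "c = 0" if "c \<in> U" for c
  proof (rule ccontr)
    assume "c \<noteq> 0"
    moreover have "- c \<in> U" using diff[OF zero that] by simp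
    ultimately have "nat \<bar>c\<bar> > 0" "int (nat \<bar>c\<bar>) \<in> U" using that by (auto simp: abs_if)
    with False show False by blast
  qed
  then show ?thesis using zero by (intro bexI[of _ 0] ballI) simp_all
next
  case True
  define n where "n = (LEAST n::nat. n > 0 \<and> int n \<in> U)"
  have n: "n > 0" "int n \<in> U" using LeastI_ex[OF True, folded n_def] by blast+
  have dvd: "int n dvd c" if "c \<in> U" for c
  proof (rule ccontr)
    assume "\<not> int n dvd c"
    then have "c mod int n \<noteq> 0" by (simp add: mod_eq_0_iff_dvd)
    moreover have "c mod int n \<ge> 0" using n(1) by simp
    ultimately have pos: "c mod int n > 0" by simp
    have "of_int (c div int n) * int n \<in> U" by (rule of_int_mult_closed[OF zero diff n(2)])
    from diff[OF that this] have "c mod int n \<in> U" by (simp only: of_int_eq_id id_apply minus_div_mult_eq_mod)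
    then have "int (nat (c mod int n)) \<in> U" using pos by (simp only: nat_0_le less_imp_le)
    then have "nat (c mod int n) > 0 \<and> int (nat (c mod int n)) \<in> U" using pos by (simp only: zero_less_nat_eq)
    then have "n \<le> nat (c mod int n)" unfolding n_def by (rule Least_le)
    moreover have "c mod int n < int n" using n(1) by (intro pos_mod_bound) simp
    ultimately show False using pos by linarith
  qed
  with n(2) show ?thesis by blast
qed

lemma int_subgroup_chain_stabilizes:
  fixes K :: "nat \<Rightarrow> int set"
  assumes zero: "\<And>j. 0 \<in> K j" and diff: "\<And>j x y. \<lbrakk>x \<in> K j; y \<in> K j\<rbrakk> \<Longrightarrow> x - y \<in> K j"
    and mono: "\<And>j. K j \<subseteq> K (Suc j)"
  shows "\<forall>\<^sub>F j in sequentially. K (Suc j) \<subseteq> K j"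
proof -
  have le: "K i \<subseteq> K j" if "i \<le> j" for i j using lift_Suc_mono_le[of K, OF mono that] .
  define U where "U = (\<Union>j. K j)"
  have U_zero: "0 \<in> U" using zero by (auto simp: U_def)
  have U_diff: "x - y \<in> U" if xy: "x \<in> U" "y \<in> U" for x y
  proof -
    obtain i j where "x \<in> K i" "y \<in> K j" using xy unfolding U_def by blast
    then have "x \<in> K (max i j)" "y \<in> K (max i j)" using le[of i "max i j"] le[of j "max i j"] by auto
    then have "x - y \<in> K (max i j)" by (rule diff)
    then show ?thesis unfolding U_def by blast
  qed
  obtain e where e: "e \<in> U" "\<And>c. c \<in> U \<Longrightarrow> e dvd c"
    using int_subgroup_principal[OF U_zero U_diff] by blast
  from e(1) obtain J where J: "e \<in> K J" unfolding U_def by blast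
  have "K (Suc j) \<subseteq> K j" if "j \<ge> J" for j
  proof
    fix c assume "c \<in> K (Suc j)"
    then have "c \<in> U" unfolding U_def by blast
    then have "e dvd c" by (rule e(2))
    then obtain k where k: "c = e * k" by (rule dvdE)
    have "e \<in> K j" using J le[OF that] by blast
    then have "of_int k * e \<in> K j"
      using of_int_mult_closed[of "K j" e k] zero[of j] diff[where j = j] by blast
    then show "c \<in> K j" using k by (simp add: mult.commute)
  qed
  then show ?thesis unfolding eventually_sequentially by blast
qed

text \<open>
  Every \<open>\<int>[Y]\<close>-submodule \<open>V\<close> of \<open>\<int>[X]\<close> is finitely generated if \<open>Y\<close> is monic of positive degree \<open>d\<close>.
  As in Hilbert's basis theorem, let \<open>L n\<close> be the group of coefficients of \<open>X\<^sup>n\<close> in elements of \<open>V\<close> of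
  degree at most \<open>n\<close>. Multiplication by \<open>Y\<close> shows that \<open>L n\<close> is contained in \<open>L (n + d)\<close>. In each of the
  \<open>d\<close> residue classes the chain becomes constant, and from then on leading coefficients are obtained
  from lower degree by multiplication by \<open>Y\<close>. The span of \<open>G\<close> is expressed as the least set \<open>U\<close> with the
  closure properties, which spares finite sums.
\<close>

lemma int_poly_submodule_finitely_generated:
  fixes V :: "int poly set"
  assumes Y: "Polynomial.lead_coeff Y = 1" "Polynomial.degree Y > 0"
    and zero: "0 \<in> V" and diff: "\<And>f g. \<lbrakk>f \<in> V; g \<in> V\<rbrakk> \<Longrightarrow> f - g \<in> V"
    and mult: "\<And>f. f \<in> V \<Longrightarrow> Y * f \<in> V"
  obtains G where "finite G" "G \<subseteq> V"
    "\<And>U. \<lbrakk>G \<subseteq> U; 0 \<in> U; \<And>f g. \<lbrakk>f \<in> U; g \<in> U\<rbrakk> \<Longrightarrow> f - g \<in> U; \<And>f. f \<in> U \<Longrightarrow> Y * f \<in> U\<rbrakk>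
       \<Longrightarrow> V \<subseteq> U"
proof -
  define d where "d = Polynomial.degree Y"
  define L where "L n = {poly.coeff f n | f. f \<in> V \<and> Polynomial.degree f \<le> n}" for n
  have "d > 0" using Y by (simp add: d_def)
  have L_zero: "0 \<in> L n" for n
    using zero unfolding L_def by (intro CollectI exI[of _ 0]) simp
  have L_diff: "x - y \<in> L n" if xy: "x \<in> L n" "y \<in> L n" for n x y
  proof -
    obtain f g where fg: "f \<in> V" "Polynomial.degree f \<le> n" "x = poly.coeff f n"
      "g \<in> V" "Polynomial.degree g \<le> n" "y = poly.coeff g n"
      using xy unfolding L_def by blast
    then have "x - y = poly.coeff (f - g) n \<and> f - g \<in> V \<and> Polynomial.degree (f - g) \<le> n"
      using diff by (simp add: degree_diff_le)
    then show ?thesis unfolding L_def by blast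
  qed
  have shift: "poly.coeff (Y * f) (n + d) = poly.coeff f n \<and> Polynomial.degree (Y * f) \<le> n + d"
    if "Polynomial.degree f \<le> n" for f n
  proof
    show "Polynomial.degree (Y * f) \<le> n + d"
      using degree_mult_le[of Y f] that by (simp add: d_def)
    show "poly.coeff (Y * f) (n + d) = poly.coeff f n"
    proof (cases "Polynomial.degree f = n")
      case True
      then show ?thesis
        using coeff_mult_degree_sum[of Y f] Y(1) by (simp add: d_def add.commute)
    next
      case False
      then have "Polynomial.degree f < n" using that by simp
      moreover from this have "Polynomial.degree (Y * f) < n + d"
        using degree_mult_le[of Y f] by (simp add: d_def)
      ultimately show ?thesis by (simp add: coeff_eq_0)
    qed
  qed
  have L_mono: "L n \<subseteq> L (n + d)" for n
  proof
    fix x assume "x \<in> L n"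
    then obtain f where "f \<in> V" "Polynomial.degree f \<le> n" "x = poly.coeff f n"
      unfolding L_def by blast
    then show "x \<in> L (n + d)"
      using shift[of f n] mult unfolding L_def by (intro CollectI exI[of _ "Y * f"]) simp
  qed
  have "\<forall>\<^sub>F j in sequentially. \<forall>r\<in>{..<d}. L (r + Suc j * d) \<subseteq> L (r + j * d)"
  proof (intro eventually_ball_finite ballI finite_lessThan)
    fix r
    show "\<forall>\<^sub>F j in sequentially. L (r + Suc j * d) \<subseteq> L (r + j * d)"
    proof (rule int_subgroup_chain_stabilizes)
      show "L (r + j * d) \<subseteq> L (r + Suc j * d)" for j
        using L_mono[of "r + j * d"] by (simp add: add_ac)
    qed (rule L_zero, rule L_diff)
  qed
  then obtain J where J: "\<And>j r. \<lbrakk>j \<ge> J; r < d\<rbrakk> \<Longrightarrow> L (r + Suc j * d) \<subseteq> L (r + j * d)"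
    unfolding eventually_sequentially by blast
  have stable: "L (n + d) \<subseteq> L n" if "n \<ge> J * d" for n
  proof -
    have "n div d \<ge> J" using that \<open>d > 0\<close> by (simp add: less_eq_div_iff_mult_less_eq)
    moreover have "n mod d < d" using \<open>d > 0\<close> by simp
    ultimately have "L (n mod d + Suc (n div d) * d) \<subseteq> L (n mod d + (n div d) * d)" by (rule J)
    moreover have "n mod d + Suc (n div d) * d = n + d"
      by (metis add.commute add.assoc mod_div_mult_eq mult_Suc)
    ultimately show ?thesis by (simp only: mod_div_mult_eq)
  qed
  have "\<exists>f. f \<in> V \<and> Polynomial.degree f \<le> n \<and> (\<forall>c\<in>L n. poly.coeff f n dvd c)" for n
  proof -
    obtain e where e: "e \<in> L n" "\<And>c. c \<in> L n \<Longrightarrow> e dvd c"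
      using int_subgroup_principal[of "L n", OF L_zero L_diff] by blast
    then show ?thesis unfolding L_def by blast
  qed
  then obtain F where F: "\<And>n. F n \<in> V" "\<And>n. Polynomial.degree (F n) \<le> n"
    "\<And>n c. c \<in> L n \<Longrightarrow> poly.coeff (F n) n dvd c"
    by metis
  show thesis
  proof (rule that[of "F ` {..<J * d + d}"])
    show "finite (F ` {..<J * d + d})" by simp
    show "F ` {..<J * d + d} \<subseteq> V" using F(1) by blast
    fix U assume U: "F ` {..<J * d + d} \<subseteq> U" "0 \<in> U" "\<And>f g. \<lbrakk>f \<in> U; g \<in> U\<rbrakk> \<Longrightarrow> f - g \<in> U"
      "\<And>f. f \<in> U \<Longrightarrow> Y * f \<in> U"
    have U_add: "f + g \<in> U" if "f \<in> U" "g \<in> U" for f g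
      using U(3)[OF that(1) U(3)[OF U(2) that(2)]] by simp
    have "f \<in> V \<longrightarrow> Polynomial.degree f < n \<longrightarrow> f \<in> U" for f n
    proof (induction n arbitrary: f)
      case (Suc n)
      show ?case
      proof (intro impI)
        assume f: "f \<in> V" "Polynomial.degree f < Suc n"
        then have c: "poly.coeff f n \<in> L n" unfolding L_def by auto
        \<comment> \<open>an element of the span with the same coefficient in degree \<open>n\<close>, to be subtracted from \<open>f\<close>\<close>
        obtain g where g: "g \<in> V" "g \<in> U" "Polynomial.degree g \<le> n" "poly.coeff g n = poly.coeff f n"
        proof (cases "n < J * d + d")
          case True
          obtain k where k: "poly.coeff f n = poly.coeff (F n) n * k" using F(3)[OF c] by (rule dvdE)
          have "of_int k * F n \<in> V" by (rule of_int_mult_closed[OF zero diff F(1)])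
          moreover have "of_int k * F n \<in> U"
            using U True by (intro of_int_mult_closed) auto
          moreover have "of_int k * F n = smult k (F n)" by (simp add: of_int_poly)
          ultimately show thesis
            using that[of "smult k (F n)"] F(2)[of n] k by (simp add: mult.commute)
        next
          case False
          define n' where "n' = n - d"
          have n': "n = n' + d" "n' \<ge> J * d" using False by (auto simp: n'_def)
          then have "poly.coeff f n \<in> L n'" using stable c by blast
          then obtain g where g: "g \<in> V" "Polynomial.degree g \<le> n'" "poly.coeff g n' = poly.coeff f n"
            unfolding L_def by auto
          have "g \<in> U" using Suc.IH[of g] g n' \<open>d > 0\<close> by simp
          then show thesis
            using that[of "Y * g"] g shift[of g n'] mult U(4) n'(1) by simp
        qed
        have "f - g \<in> U"
        proof (cases "f - g = 0")
          case False
          have le: "Polynomial.degree (f - g) \<le> n" using f g by (intro degree_diff_le) auto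
          moreover have "Polynomial.degree (f - g) \<noteq> n"
          proof
            assume "Polynomial.degree (f - g) = n"
            moreover have "poly.coeff (f - g) n = 0" using g by simp
            ultimately show False using False leading_coeff_0_iff[of "f - g"] by simp
          qed
          ultimately show ?thesis using Suc.IH[of "f - g"] diff f g by simp
        qed (use U in simp)
        then have "(f - g) + g \<in> U" using g U_add by blast
        then show "f \<in> U" by simp
      qed
    qed simp
    then show "V \<subseteq> U" by blast
  qed
qed

context conductor_square
begin

text \<open>
  An ideal \<open>J\<close> of \<open>A\<close> is generated by its polynomials, which form a \<open>\<int>[Y]\<close>-submodule of \<open>\<int>[X]\<close>.
  Its finitely many generators generate \<open>J\<close>.
\<close>

lemma noetherian_A: "noetherian_domain (ring_on A)"
proof -
  have "noetherian_ring (ring_on A)"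
  proof (rule A.noetherian_ringI)
    fix J assume "ideal J (ring_on A)"
    then interpret J: ideal J "ring_on A" .
    have "J \<subseteq> A" using J.Icarr by auto
    obtain Y where Y: "Y \<in> E" "Polynomial.lead_coeff Y = 1" "Polynomial.degree Y > 0"
      using monic by blast
    have closed: "Fract 0 1 \<in> K" "Fract (f - g) 1 \<in> K" "Fract (h * f) 1 \<in> K"
      if "ideal K (ring_on A)" "Fract f 1 \<in> K" "Fract g 1 \<in> K" "h \<in> E" for K f g h
    proof -
      interpret K: ideal K "ring_on A" by fact
      have c: "Fract f 1 \<in> A" "Fract g 1 \<in> A" using K.Icarr that by auto
      show "Fract 0 1 \<in> K"
        using additive_subgroup.zero_closed[OF ideal.axioms(1)[OF that(1)]] by (simp add: fract_collapse)
      have "Fract f 1 \<oplus>\<^bsub>ring_on A\<^esub> (\<ominus>\<^bsub>ring_on A\<^esub> Fract g 1) \<in> K"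
        using that(2,3) additive_subgroup.a_closed[OF K.additive_subgroup_axioms]
          additive_subgroup.a_inv_closed[OF K.additive_subgroup_axioms] by blast
      moreover have "\<ominus>\<^bsub>ring_on A\<^esub> Fract g 1 = - Fract g 1" using A.value_a_inv c by simp
      ultimately show "Fract (f - g) 1 \<in> K" by simp
      have "Fract h 1 \<in> A" using that denominator_one by (auto intro: mem_A)
      then have "Fract h 1 \<otimes>\<^bsub>ring_on A\<^esub> Fract f 1 \<in> K"
        by (intro K.I_l_closed that(2)) simp
      then show "Fract (h * f) 1 \<in> K" by simp
    qed
    have J0: "Fract 0 1 \<in> J" 
      using additive_subgroup.zero_closed[OF J.additive_subgroup_axioms] by (simp add: fract_collapse)
    obtain G where G: "finite G" "G \<subseteq> {f. Fract f 1 \<in> J}"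
      "\<And>U. \<lbrakk>G \<subseteq> U; 0 \<in> U; \<And>f g. \<lbrakk>f \<in> U; g \<in> U\<rbrakk> \<Longrightarrow> f - g \<in> U; \<And>f. f \<in> U \<Longrightarrow> Y * f \<in> U\<rbrakk>
         \<Longrightarrow> {f. Fract f 1 \<in> J} \<subseteq> U"
    proof (rule int_poly_submodule_finitely_generated[OF Y(2,3), of "{f. Fract f 1 \<in> J}"])
      show "0 \<in> {f. Fract f 1 \<in> J}" using J0 by simp
      show "f - g \<in> {f. Fract f 1 \<in> J}" if "f \<in> {f. Fract f 1 \<in> J}" "g \<in> {f. Fract f 1 \<in> J}" for f g
        using that closed(2)[OF J.is_ideal, of f g Y] Y by simp
      show "Y * f \<in> {f. Fract f 1 \<in> J}" if "f \<in> {f. Fract f 1 \<in> J}" for f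
        using that closed(3)[OF J.is_ideal, of f f Y] Y by simp
    qed blast
    define W where "W = (\<lambda>f. Fract f 1) ` G"
    have WJ: "W \<subseteq> J" using G(2) by (auto simp: W_def)
    then have WA: "W \<subseteq> carrier (ring_on A)" using \<open>J \<subseteq> A\<close> by simp
    define K where "K = Idl\<^bsub>ring_on A\<^esub> W"
    have K: "ideal K (ring_on A)" unfolding K_def by (rule A.genideal_ideal[OF WA])
    interpret K: ideal K "ring_on A" by (rule K)
    have WK: "W \<subseteq> K" unfolding K_def by (rule A.genideal_self[OF WA])
    have KJ: "K \<subseteq> J" unfolding K_def by (rule A.genideal_minimal[OF J.is_ideal WJ])
    have "{f. Fract f 1 \<in> J} \<subseteq> {f. Fract f 1 \<in> K}"
    proof (rule G(3))
      show "G \<subseteq> {f. Fract f 1 \<in> K}" using WK by (auto simp: W_def)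
      show "0 \<in> {f. Fract f 1 \<in> K}"
        using additive_subgroup.zero_closed[OF K.additive_subgroup_axioms] by (simp add: fract_collapse)
      show "f - g \<in> {f. Fract f 1 \<in> K}" if "f \<in> {f. Fract f 1 \<in> K}" "g \<in> {f. Fract f 1 \<in> K}" for f g
        using that closed(2)[OF K, of f g Y] Y by simp
      show "Y * f \<in> {f. Fract f 1 \<in> K}" if "f \<in> {f. Fract f 1 \<in> K}" for f
        using that closed(3)[OF K, of f f Y] Y by simp
    qed
    have "x \<in> K" if "x \<in> J" for x
    proof -
      have "x \<in> A" using that \<open>J \<subseteq> A\<close> by blast
      then obtain f g where x: "f \<in> E" "g \<in> E" "g \<notin> I" "g \<noteq> 0" "x = Fract f g" by (rule A_cases)
      have gA: "Fract g 1 \<in> A" "Fract 1 g \<in> A" using x E_one denominator_one by (auto intro: mem_A)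
      have "Fract g 1 * x \<in> J" using J.I_l_closed[OF that] gA by simp
      moreover have "Fract g 1 * x = Fract f 1" using x by (simp add: eq_fract)
      ultimately have "Fract f 1 \<in> K" using \<open>{f. Fract f 1 \<in> J} \<subseteq> {f. Fract f 1 \<in> K}\<close> by auto
      then have "Fract 1 g \<otimes>\<^bsub>ring_on A\<^esub> Fract f 1 \<in> K" by (rule K.I_l_closed) (use gA in simp)
      then show ?thesis using x by simp
    qed
    then have "J = Idl\<^bsub>ring_on A\<^esub> W" using KJ unfolding K_def by blast
    moreover have "finite W" using G(1) by (simp add: W_def)
    ultimately show "\<exists>W\<subseteq>carrier (ring_on A). finite W \<and> J = Idl\<^bsub>ring_on A\<^esub> W" using WA by blast
  qed
  then show ?thesis using A.domain_axioms by (intro noetherian_domain.intro)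
qed

end

section \<open>Regular local rings of dimension at most one\<close>

lemma strict_chain_subset:
  fixes P :: "nat \<Rightarrow> 'a set"
  assumes "\<forall>i<n. P i \<subset> P (Suc i)" "i < j" "j \<le> n"
  shows "P i \<subset> P j"
  using assms(2,3)
proof (induction j)
  case (Suc j)
  then have "P j \<subset> P (Suc j)" using assms(1) by simp
  moreover have "P i \<subset> P j" if "i \<noteq> j" using Suc that by simp
  ultimately show ?case by (cases "i = j") (auto intro: psubset_trans)
qed simp

lemma chain_length_less_card:
  fixes P :: "nat \<Rightarrow> 'a set"
  assumes chain: "\<forall>i<n. P i \<subset> P (Suc i)" and Q: "finite Q" "\<And>i. i \<le> n \<Longrightarrow> P i \<in> Q"
  shows "n < card Q"
proof -
  have "inj_on P {..n}"
  proof (rule inj_onI)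
    fix i j assume "i \<in> {..n}" "j \<in> {..n}" "P i = P j"
    then show "i = j"
      using strict_chain_subset[OF chain, of i j] strict_chain_subset[OF chain, of j i]
      by (cases i j rule: linorder_cases) auto
  qed
  then have "card {..n} \<le> card Q" by (rule card_inj_on_le) (use Q in auto)
  then show ?thesis by simp
qed

lemma prime_height_ge:
  assumes "\<forall>i\<le>n. primeideal (P i) R" "\<forall>i<n. P i \<subset> P (Suc i)"
  shows "enat n \<le> prime_height R (P n)"
  unfolding prime_height_def using assms by (intro Sup_upper) blast

text \<open>A strict chain of primes inside a set of \<open>n + 1\<close> primes has length at most \<open>n\<close>.\<close>

lemma krull_dim_eq:
  assumes Q: "finite Q" "card Q = Suc n" "\<And>p. primeideal p R \<Longrightarrow> p \<in> Q"
    and P: "\<forall>i\<le>n. primeideal (P i) R" "\<forall>i<n. P i \<subset> P (Suc i)"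
  shows "krull_dim R = enat n"
proof (rule antisym)
  show "krull_dim R \<le> enat n"
    unfolding krull_dim_def prime_height_def
  proof (intro SUP_least Sup_least)
    fix p x
    assume "x \<in> {enat k | k. \<exists>P. (\<forall>i\<le>k. primeideal (P i) R) \<and> (\<forall>i<k. P i \<subset> P (Suc i)) \<and> P k = p}"
    then obtain k P where k: "x = enat k" "\<forall>i\<le>k. primeideal (P i) R" "\<forall>i<k. P i \<subset> P (Suc i)"
      by blast
    have "k < card Q"
      by (rule chain_length_less_card[OF k(3) Q(1)]) (use k(2) Q(3) in blast)
    then show "x \<le> enat n" using k(1) Q(2) by simp
  qed
  have "enat n \<le> prime_height R (P n)" by (rule prime_height_ge[OF P])
  also have "\<dots> \<le> krull_dim R"
    unfolding krull_dim_def by (rule SUP_upper) (use P(1) in simp)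
  finally show "enat n \<le> krull_dim R" .
qed

lemma (in field) regular_local_ring_field: "regular_local_ring R"
proof -
  have ideals: "J = {\<zero>} \<or> J = carrier R" if "ideal J R" for J
    using that all_ideals by blast
  have zero_mem: "\<zero> \<in> J" if "ideal J R" for J
    using additive_subgroup.zero_closed[OF ideal.axioms(1)[OF that]] .
  have Idl_empty: "{\<zero>} = Idl {}"
    using genideal_minimal[OF zeroideal, of "{}"] zero_mem[OF genideal_ideal[of "{}"]] by blast
  have "noetherian_ring R"
  proof (rule noetherian_ringI)
    fix J assume "ideal J R"
    then consider "J = {\<zero>}" | "J = carrier R" using ideals by blast
    then show "\<exists>W\<subseteq>carrier R. finite W \<and> J = Idl W"
    proof cases
      case 1
      with Idl_empty show ?thesis by (intro exI[of _ "{}"]) simp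
    next
      case 2
      with genideal_one show ?thesis by (intro exI[of _ "{\<one>}"]) simp
    qed
  qed
  moreover have "local_ring R {\<zero>}"
    unfolding local_ring_def
  proof (intro conjI allI impI is_cring zeromaximalideal)
    fix J assume "maximalideal J R"
    then show "J = {\<zero>}"
      using ideals[OF maximalideal.axioms(1)] maximalideal.I_notcarr[of J R] by blast
  qed
  moreover have "krull_dim R = enat 0"
  proof (rule krull_dim_eq[of "{{\<zero>}}" _ _ "\<lambda>_. {\<zero>}"])
    fix p assume "primeideal p R"
    then show "p \<in> {{\<zero>}}"
      using ideals[OF primeideal.axioms(1)] primeideal.I_notcarr[of p R] by blast
  qed (simp_all add: zeroprimeideal)
  ultimately show ?thesis
    unfolding regular_local_ring_def using Idl_empty
    by (intro conjI exI[of _ "{\<zero>}"] exI[of _ "{}"]) simp_all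
qed

text \<open>
  If every nonzero element is a power of \<open>t\<close> times a unit, the nonzero ideals are generated by
  powers of \<open>t\<close>, and the only primes are 0 and \<open>(t)\<close>.
\<close>

lemma (in domain) regular_local_ring_uniformizer:
  assumes t: "t \<in> carrier R" "t \<noteq> \<zero>" "t \<notin> Units R"
    and dec: "\<And>x. \<lbrakk>x \<in> carrier R; x \<noteq> \<zero>\<rbrakk> \<Longrightarrow> \<exists>k. \<exists>u\<in>Units R. x = t [^] (k::nat) \<otimes> u"
  shows "regular_local_ring R"
proof -
  have pow_mem: "t [^] k \<in> J" if J: "ideal J R" "t [^] k \<otimes> u \<in> J" "u \<in> Units R" for J u and k :: nat
  proof -
    have "(t [^] k \<otimes> u) \<otimes> inv u \<in> J" using ideal.I_r_closed[OF J(1,2)] J(3) by simp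
    moreover have "(t [^] k \<otimes> u) \<otimes> inv u = t [^] k"
      using t(1) J(3) by (simp add: m_assoc Units_closed)
    ultimately show ?thesis by (simp only:)
  qed
  have principal: "\<exists>a\<in>carrier R. J = PIdl a" if J: "ideal J R" for J
  proof (cases "J = {\<zero>}")
    case True
    then show ?thesis
      using cgenideal_eq_genideal[of \<zero>] genideal_zero by (intro bexI[of _ \<zero>]) simp_all
  next
    case False
    interpret J: ideal J R by fact
    have "\<zero> \<in> J" using additive_subgroup.zero_closed[OF J.additive_subgroup_axioms] .
    then obtain x where x: "x \<in> J" "x \<noteq> \<zero>" using False by blast
    then obtain k u where "u \<in> Units R" "x = t [^] (k::nat) \<otimes> u" using dec J.Icarr by blast
    then have ex: "\<exists>k::nat. t [^] k \<in> J" using pow_mem[OF J] x by blast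
    define n where "n = (LEAST k::nat. t [^] k \<in> J)"
    have n: "t [^] n \<in> J" using LeastI_ex[OF ex] by (simp add: n_def)
    have "y \<in> PIdl (t [^] n)" if y: "y \<in> J" for y
    proof (cases "y = \<zero>")
      case True
      have "ideal (PIdl (t [^] n)) R" using t(1) by (intro cgenideal_ideal) simp
      with True show ?thesis
        using additive_subgroup.zero_closed[OF ideal.axioms(1)] by blast
    next
      case False
      then obtain k u where ku: "u \<in> Units R" "y = t [^] (k::nat) \<otimes> u" using dec J.Icarr y by blast
      then have "t [^] k \<in> J" using pow_mem[OF J] y by blast
      then have "n \<le> k" unfolding n_def by (rule Least_le)
      then have "t [^] k = t [^] (k - n) \<otimes> t [^] n" using t by (simp add: nat_pow_mult)
      then have "y = (t [^] (k - n) \<otimes> u) \<otimes> t [^] n"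
        using ku t(1) by (simp add: m_ac Units_closed)
      then show ?thesis using ku t unfolding cgenideal_def by blast
    qed
    moreover have "PIdl (t [^] n) \<subseteq> J" by (rule cgenideal_minimal[OF J n])
    ultimately show ?thesis using t by (intro bexI[of _ "t [^] n"]) auto
  qed
  then interpret PD: principal_domain R by unfold_locales
  have noeth: "noetherian_ring R" by (rule PD.noetherian_ring_axioms)
  let ?m = "PIdl t"
  have m: "ideal ?m R" by (rule cgenideal_ideal[OF t(1)])
  have t_m: "t \<in> ?m" by (rule cgenideal_self[OF t(1)])
  have one_m: "\<one> \<notin> ?m"
  proof
    assume "\<one> \<in> ?m"
    then obtain x where x: "x \<in> carrier R" "\<one> = x \<otimes> t" unfolding cgenideal_def by blast
    then have "t \<otimes> x = \<one>" using t(1) m_comm by simp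
    with x have "t \<in> Units R" using t(1) unfolding Units_def by auto
    with t(3) show False ..
  qed
  have unit: "x \<in> Units R" if x: "x \<in> carrier R" "x \<notin> ?m" for x
  proof -
    have "\<zero> \<in> ?m" using additive_subgroup.zero_closed[OF ideal.axioms(1)[OF m]] .
    then have "x \<noteq> \<zero>" using x by blast
    then obtain k u where ku: "u \<in> Units R" "x = t [^] (k::nat) \<otimes> u" using dec x by blast
    have "k = 0"
    proof (rule ccontr)
      assume "k \<noteq> 0"
      then obtain j where "k = Suc j" by (cases k) auto
      then have "x = (t [^] j \<otimes> u) \<otimes> t"
        using ku t(1) by (simp add: m_ac Units_closed)
      then have "x \<in> ?m" using ku t unfolding cgenideal_def by blast
      with x show False by blast
    qed
    then show ?thesis using ku by simp
  qed
  have proper: "J \<subseteq> ?m" if J: "ideal J R" "J \<noteq> carrier R" for J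
  proof
    fix x assume x: "x \<in> J"
    show "x \<in> ?m"
    proof (rule ccontr)
      assume "x \<notin> ?m"
      then have "x \<in> Units R" using unit x ideal.Icarr[OF J(1)] by blast
      then have "inv x \<otimes> x \<in> J" "inv x \<otimes> x = \<one>"
        using ideal.I_l_closed[OF J(1) x, of "inv x"] by simp_all
      then show False using ideal.one_imp_carrier[OF J(1)] J(2) by simp
    qed
  qed
  have max_m: "maximalideal ?m R"
  proof (rule maximalidealI[OF m])
    show "carrier R \<noteq> ?m" using one_m by blast
    fix J assume "ideal J R" "?m \<subseteq> J" "J \<subseteq> carrier R"
    then show "J = ?m \<or> J = carrier R" using proper by blast
  qed
  have "local_ring R ?m"
    unfolding local_ring_def
  proof (intro conjI allI impI is_cring max_m)
    fix J assume "maximalideal J R"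
    then interpret J: maximalideal J R .
    show "J = ?m"
      using proper[OF J.is_ideal] J.I_notcarr J.I_maximal[OF m] maximalideal.I_notcarr[OF max_m]
        additive_subgroup.a_subset[OF ideal.axioms(1)[OF m]] by auto
  qed
  moreover have "krull_dim R = enat 1"
  proof (rule krull_dim_eq[of "{{\<zero>}, ?m}" _ _ "\<lambda>i. if i = 0 then {\<zero>} else ?m"])
    have ne: "{\<zero>} \<noteq> ?m" using t_m t(2) by blast
    then show "card {{\<zero>}, ?m} = Suc 1" by simp
    show "p \<in> {{\<zero>}, ?m}" if p: "primeideal p R" for p
    proof (cases "p = {\<zero>}")
      case False
      interpret p: primeideal p R by fact
      have "\<zero> \<in> p" using additive_subgroup.zero_closed[OF p.additive_subgroup_axioms] .
      then obtain x where x: "x \<in> p" "x \<noteq> \<zero>" using False by blast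
      then obtain k u where ku: "u \<in> Units R" "x = t [^] (k::nat) \<otimes> u" using dec p.Icarr by blast
      then have tk: "t [^] k \<in> p" using pow_mem[OF p.is_ideal] x by blast
      have "t [^] k \<in> p \<Longrightarrow> t \<in> p" for k :: nat
      proof (induction k)
        case 0
        then show ?case using p.one_imp_carrier p.I_notcarr by simp
      next
        case (Suc k)
        then show ?case using p.I_prime[of "t [^] k" t] t by auto
      qed
      then have "t \<in> p" using tk by blast
      then have "?m \<subseteq> p" by (rule cgenideal_minimal[OF p.is_ideal])
      then show ?thesis using proper[OF p.is_ideal] p.I_notcarr by auto
    qed simp
    show "\<forall>i\<le>1. primeideal (if i = 0 then {\<zero>} else ?m) R"
      using zeroprimeideal maximalideal_prime[OF max_m] by simp
    have "{\<zero>} \<subset> ?m" using ne additive_subgroup.zero_closed[OF ideal.axioms(1)[OF m]] by blast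
    then show "\<forall>i<1. (if i = 0 then {\<zero>} else ?m) \<subset> (if Suc i = 0 then {\<zero>} else ?m)"
      by simp
  qed simp
  moreover have "?m = Idl {t}" by (rule cgenideal_eq_genideal[OF t(1)])
  ultimately show ?thesis
    unfolding regular_local_ring_def using noeth t(1)
    by (intro conjI exI[of _ ?m] exI[of _ "{t}"]) simp_all
qed

section \<open>Serre's condition \<open>(R\<^sub>1)\<close>\<close>

context conductor_square
begin

text \<open>The contraction to \<open>A\<close> of the ideal \<open>q B\<close>.\<close>

definition divisible_by :: "int poly \<Rightarrow> int poly fract set" where
  "divisible_by q = {x \<in> A. \<exists>f g. g \<in> E - I \<and> q dvd f \<and> x = Fract f g}"

lemma Fract_divisible_iff:
  assumes q: "prime_elem q" "\<And>g. g \<in> E - I \<Longrightarrow> \<not> q dvd g" and g: "g \<in> E - I" and A: "Fract f g \<in> A"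
  shows "Fract f g \<in> divisible_by q \<longleftrightarrow> q dvd f"
proof
  assume "Fract f g \<in> divisible_by q"
  then obtain f' g' where f': "g' \<in> E - I" "q dvd f'" "Fract f g = Fract f' g'"
    unfolding divisible_by_def by blast
  then have "f * g' = f' * g"
    using denominator_nonzero g by (simp add: eq_fract)
  then have "q dvd f * g'" using f'(2) by simp
  then show "q dvd f" using q f'(1) prime_elem_dvd_mult_iff by blast
qed (use g A in \<open>auto simp: divisible_by_def\<close>)

lemma prime_divisible_by:
  assumes q: "prime_elem q" "\<And>g. g \<in> E - I \<Longrightarrow> \<not> q dvd g"
  shows "primeideal (divisible_by q) (ring_on A)"
proof -
  note iff = Fract_divisible_iff[OF q]
  have sub: "divisible_by q \<subseteq> A" by (auto simp: divisible_by_def)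
  have cases: "\<exists>f g. f \<in> E \<and> g \<in> E - I \<and> g \<noteq> 0 \<and> x = Fract f g" if "x \<in> A" for x
    using that by (elim A_cases) blast
  have "ideal {x \<in> carrier (ring_on A). x \<in> divisible_by q} (ring_on A)"
  proof (rule A.value_ideal)
    have "Fract 0 1 \<in> divisible_by q"
      using iff[of 1 0] denominator_one zero_in_I I_sub mem_A[of 0 1] by auto
    then show "0 \<in> divisible_by q" by (simp add: fract_collapse)
    show "x \<in> (\<lambda>x. x) ` carrier (ring_on A)" if "x \<in> divisible_by q" for x
      using that sub by auto
    fix x y assume x: "x \<in> divisible_by q"
    then obtain f g where f: "f \<in> E" "g \<in> E - I" "g \<noteq> 0" "x = Fract f g" using cases sub by blast
    then have qf: "q dvd f" using iff x sub by blast
    show "x + y \<in> divisible_by q" if y: "y \<in> divisible_by q"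
    proof -
      obtain f' g' where f': "f' \<in> E" "g' \<in> E - I" "g' \<noteq> 0" "y = Fract f' g'" using cases sub y by blast
      then have "q dvd f'" using iff y sub by blast
      then have "q dvd f * g' + f' * g" using qf by simp
      moreover have "x + y \<in> A" using x y sub subring_A by (auto simp: unital_subring_def)
      ultimately show ?thesis
        using iff[of "g * g'" "f * g' + f' * g"] f f' denominator_mult[of g g'] by simp
    qed
    show "y * x \<in> divisible_by q" if y: "y \<in> (\<lambda>x. x) ` carrier (ring_on A)"
    proof -
      have "y \<in> A" using y by simp
      then obtain f' g' where f': "f' \<in> E" "g' \<in> E - I" "g' \<noteq> 0" "y = Fract f' g'" using cases by blast
      moreover have "y * x \<in> A" using x \<open>y \<in> A\<close> sub subring_A by (auto simp: unital_subring_def)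
      ultimately show ?thesis
        using iff[of "g' * g" "f' * f"] f qf denominator_mult[of g' g] by simp
    qed
  qed
  then have ideal: "ideal (divisible_by q) (ring_on A)"
    using sub by (simp add: Int_absorb1 Collect_conj_eq)
  show ?thesis
  proof (rule primeidealI[OF ideal A.is_cring])
    have "\<not> q dvd 1" using q(2) denominator_one by blast
    then have "Fract 1 1 \<notin> divisible_by q" using iff[of 1 1] denominator_one mem_A[of 1 1] by auto
    then show "carrier (ring_on A) \<noteq> divisible_by q"
      using A.one_closed by (auto simp: fract_collapse)
    fix x y assume "x \<in> carrier (ring_on A)" "y \<in> carrier (ring_on A)"
      and xy: "x \<otimes>\<^bsub>ring_on A\<^esub> y \<in> divisible_by q"
    then have xyA: "x \<in> A" "y \<in> A" by simp_all
    obtain f g where f: "f \<in> E" "g \<in> E - I" "g \<noteq> 0" "x = Fract f g" using cases xyA(1) by blast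
    obtain f' g' where f': "f' \<in> E" "g' \<in> E - I" "g' \<noteq> 0" "y = Fract f' g'" using cases xyA(2) by blast
    have "Fract (f * f') (g * g') \<in> divisible_by q" using xy f f' by simp
    then have "q dvd f * f'" using iff[of "g * g'" "f * f'"] denominator_mult[OF f(2) f'(2)] sub by blast
    then have "q dvd f \<or> q dvd f'" using q(1) prime_elem_dvd_mult_iff by blast
    then show "x \<in> divisible_by q \<or> y \<in> divisible_by q"
      using iff[of g f] iff[of g' f'] f f' xyA by blast
  qed
qed

lemma localization_of_A:
  assumes "primeideal P (ring_on A)"
  shows "embedded_localization (ring_on A) (\<lambda>x. x) (A - P)"
proof -
  have eq: "(ring_on A)\<lparr>carrier := A\<rparr> = ring_on A" by (simp add: ring_on_def)
  show ?thesis
    by (rule A.prime_complement_localization) (use assms A.one_closed in \<open>simp_all add: eq\<close>)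
qed

lemma regular_at_zero:
  assumes P: "primeideal {0} (ring_on A)"
  shows "regular_local_ring (localization (ring_on A) (A - {0}))"
proof -
  interpret L: embedded_localization "ring_on A" "\<lambda>x. x" "A - {0}"
    by (rule localization_of_A[OF P])
  let ?L = "localization (ring_on A) (A - {0})"
  interpret LE: field_embedding ?L v by (rule L.localization_embedding)
  have "field ?L"
  proof (rule LE.cring_fieldI2)
    show "\<zero>\<^bsub>?L\<^esub> \<noteq> \<one>\<^bsub>?L\<^esub>" by simp
    fix x assume x: "x \<in> carrier ?L" "x \<noteq> \<zero>\<^bsub>?L\<^esub>"
    then obtain a s where a: "a \<in> A" "s \<in> A - {0}" "x = fraction (ring_on A) (A - {0}) a s"
      by (elim L.fraction_cases) simp
    have "v x \<noteq> 0" using x LE.value_eq_zero_iff by blast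
    then have "a \<noteq> 0" using a by (auto simp: L.frac_value_fraction)
    define y where "y = fraction (ring_on A) (A - {0}) s a"
    have y: "y \<in> carrier ?L" unfolding y_def using a \<open>a \<noteq> 0\<close> by (intro L.fraction_in) auto
    have "x \<otimes>\<^bsub>?L\<^esub> y = \<one>\<^bsub>?L\<^esub>"
    proof (rule LE.value_eqI)
      have "v x = a / s" "v y = s / a"
        using a \<open>a \<noteq> 0\<close> by (simp_all add: y_def L.frac_value_fraction)
      then show "v (x \<otimes>\<^bsub>?L\<^esub> y) = v \<one>\<^bsub>?L\<^esub>"
        using x y a \<open>a \<noteq> 0\<close> by (simp add: LE.value_mult LE.value_one)
    qed (use x y in simp_all)
    with y show "\<exists>y\<in>carrier ?L. x \<otimes>\<^bsub>?L\<^esub> y = \<one>\<^bsub>?L\<^esub>" by blast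
  qed
  then show ?thesis by (rule field.regular_local_ring_field)
qed

text \<open>
  The image of the localization is \<open>\<int>[X]\<close> localized at \<open>(q)\<close>: an element \<open>c\<close> of \<open>M\<close> outside the prime
  becomes invertible and multiplies \<open>B\<close> into \<open>A\<close>. So \<open>f / g = (c f) / (c g)\<close> whenever \<open>q\<close> does not divide \<open>g\<close>,
  and \<open>q\<close> is a uniformizer.
\<close>

lemma regular_at_divisible_by:
  assumes q: "prime_elem q" "\<And>g. g \<in> E - I \<Longrightarrow> \<not> q dvd g" and c: "c \<in> M" "c \<notin> divisible_by q"
  shows "regular_local_ring (localization (ring_on A) (A - divisible_by q))"
proof -
  let ?P = "divisible_by q"
  note iff = Fract_divisible_iff[OF q]
  interpret L: embedded_localization "ring_on A" "\<lambda>x. x" "A - ?P"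
    by (rule localization_of_A[OF prime_divisible_by[OF q]])
  let ?L = "localization (ring_on A) (A - ?P)"
  interpret LE: field_embedding ?L v by (rule L.localization_embedding)
  obtain c1 c2 where c12: "c1 \<in> I" "c2 \<in> E" "c2 \<notin> I" "c2 \<noteq> 0" "c = Fract c1 c2"
    using c(1) by (rule M_cases)
  have cA: "Fract (c1 * f) c2 \<in> A" for f
    using c12 I_mult[of c1 f] I_sub by (auto intro: mem_A simp: mult.commute)
  have q_c1: "\<not> q dvd c1"
    using c c12 iff[of c2 c1] cA[of 1] by auto
  then have "c1 \<noteq> 0" by auto
  have exists: "\<exists>x\<in>carrier ?L. v x = Fract f g" if g: "\<not> q dvd g" for f g
  proof -
    have "\<not> q dvd c1 * g" using q(1) q_c1 g prime_elem_dvd_mult_iff by blast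
    then have s: "Fract (c1 * g) c2 \<in> A - ?P" using iff[of c2 "c1 * g"] cA[of g] c12 by auto
    have "g \<noteq> 0" using g by auto
    then have "Fract f g = Fract (c1 * f) c2 / Fract (c1 * g) c2"
      using c12 \<open>c1 \<noteq> 0\<close> by (simp add: eq_fract)
    then show ?thesis
      using s cA[of f] by (intro bexI[of _ "fraction (ring_on A) (A - ?P) (Fract (c1 * f) c2) (Fract (c1 * g) c2)"])
        (simp_all only: L.frac_value_fraction L.fraction_in ring_on_simps)
  qed
  have range: "\<exists>f g. \<not> q dvd g \<and> v x = Fract f g" if "x \<in> carrier ?L" for x
  proof -
    obtain a s where a: "a \<in> A" "s \<in> A - ?P" "x = fraction (ring_on A) (A - ?P) a s"
      using \<open>x \<in> carrier ?L\<close> by (elim L.fraction_cases) simp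
    obtain f g where f: "g \<in> E" "g \<notin> I" "a = Fract f g" using a(1) by (elim A_cases)
    have "s \<in> A" using a(2) by blast
    then obtain f' g' where f': "g' \<in> E" "g' \<notin> I" "s = Fract f' g'" by (elim A_cases)
    have "\<not> q dvd f'" using a(2) f' iff[of g' f'] by auto
    moreover have "\<not> q dvd g" using q(2) f by blast
    ultimately have "\<not> q dvd g * f'" using q(1) prime_elem_dvd_mult_iff by blast
    moreover have "v x = Fract (f * g') (g * f')"
      using a f f' by (simp add: L.frac_value_fraction)
    ultimately show ?thesis by blast
  qed
  have unit: "x \<in> Units ?L" if x: "x \<in> carrier ?L" "v x = Fract f g" "\<not> q dvd f" "\<not> q dvd g" for x f g
  proof -
    obtain y where y: "y \<in> carrier ?L" "v y = Fract g f" using exists[OF x(3)] by blast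
    have "f \<noteq> 0" "g \<noteq> 0" using x by auto
    have "x \<otimes>\<^bsub>?L\<^esub> y = \<one>\<^bsub>?L\<^esub>"
    proof (rule LE.value_eqI)
      show "v (x \<otimes>\<^bsub>?L\<^esub> y) = v \<one>\<^bsub>?L\<^esub>"
        using x y \<open>f \<noteq> 0\<close> \<open>g \<noteq> 0\<close>
        by (simp add: LE.value_mult LE.value_one One_fract_def eq_fract)
    qed (use x y in simp_all)
    moreover from this have "y \<otimes>\<^bsub>?L\<^esub> x = \<one>\<^bsub>?L\<^esub>" using LE.m_comm[OF x(1) y(1)] by simp
    ultimately show ?thesis using x(1) y(1) unfolding Units_def by blast
  qed
  have q1: "\<not> q dvd 1" using q(1) by (simp add: prime_elem_not_unit)
  obtain t where t: "t \<in> carrier ?L" "v t = Fract q 1" using exists[OF q1] by blast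
  have "q \<noteq> 0" using q(1) by auto
  show ?thesis
  proof (rule LE.regular_local_ring_uniformizer[OF t(1)])
    show "t \<noteq> \<zero>\<^bsub>?L\<^esub>"
      using t \<open>q \<noteq> 0\<close> LE.value_eq_zero_iff[OF t(1)] by (simp add: Zero_fract_def eq_fract)
    show "t \<notin> Units ?L"
    proof
      assume "t \<in> Units ?L"
      then obtain y where y: "y \<in> carrier ?L" "t \<otimes>\<^bsub>?L\<^esub> y = \<one>\<^bsub>?L\<^esub>" unfolding Units_def by blast
      then have "v t * v y = 1" using LE.value_mult[OF t(1) y(1)] LE.value_one by simp
      moreover obtain f g where f: "\<not> q dvd g" "v y = Fract f g" using range[OF y(1)] by blast
      moreover have "g \<noteq> 0" using f by auto
      ultimately have "q * f = g" using t f by (simp add: One_fract_def eq_fract)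
      with f show False by auto
    qed
    fix x assume x: "x \<in> carrier ?L" "x \<noteq> \<zero>\<^bsub>?L\<^esub>"
    obtain f g where f: "\<not> q dvd g" "v x = Fract f g" using range[OF x(1)] by blast
    have "f \<noteq> 0" using f x LE.value_eq_zero_iff[OF x(1)] by (auto simp: fract_collapse)
    then obtain f' where f': "f = q ^ multiplicity q f * f'" "\<not> q dvd f'"
      using multiplicity_decompose'[of f q] prime_elem_not_unit[OF q(1)] by blast
    obtain u where u: "u \<in> carrier ?L" "v u = Fract f' g" using exists[OF f(1)] by blast
    have "x = t [^]\<^bsub>?L\<^esub> multiplicity q f \<otimes>\<^bsub>?L\<^esub> u"
    proof (rule LE.value_eqI)
      show "v x = v (t [^]\<^bsub>?L\<^esub> multiplicity q f \<otimes>\<^bsub>?L\<^esub> u)"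
        using t u f f'(1) by (simp add: LE.value_mult LE.value_nat_pow Fract_power)
    qed (use x t u in simp_all)
    moreover have "u \<in> Units ?L" using unit u f f' by blast
    ultimately show "\<exists>k. \<exists>u\<in>Units ?L. x = t [^]\<^bsub>?L\<^esub> (k::nat) \<otimes>\<^bsub>?L\<^esub> u" by blast
  qed
qed

lemma height_two:
  assumes P: "primeideal P (ring_on A)" and Q: "primeideal Q (ring_on A)" and "Q \<subset> P" "Q \<noteq> {0}"
  shows "\<not> prime_height (ring_on A) P \<le> 1"
proof
  assume le: "prime_height (ring_on A) P \<le> 1"
  have "0 \<in> Q"
    using additive_subgroup.zero_closed[OF ideal.axioms(1)[OF primeideal.axioms(1)[OF Q]]] by simp
  define C where "C = (\<lambda>i::nat. if i = 0 then {0} else if i = 1 then Q else P)"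
  have "enat 2 \<le> prime_height (ring_on A) (C 2)"
  proof (rule prime_height_ge)
    show "\<forall>i\<le>2. primeideal (C i) (ring_on A)"
      using P Q A.zeroprimeideal by (simp add: C_def)
    show "\<forall>i<2. C i \<subset> C (Suc i)"
      using assms(3,4) \<open>0 \<in> Q\<close> by (auto simp: C_def less_2_cases_iff)
  qed
  also have "\<dots> \<le> 1" using le by (simp add: C_def)
  finally show False by (simp add: one_enat_def)
qed

text \<open>
  A nonzero prime \<open>P\<close> of height at most 1 differs from \<open>M\<close>, so it misses some \<open>c\<close> in \<open>M\<close>, and \<open>c B\<close> is contained
  in \<open>A\<close>. A nonzero polynomial in \<open>P\<close> has a prime factor \<open>q\<close> with \<open>c q\<close> in \<open>P\<close>. Then the multiples of \<open>q\<close>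
  in \<open>A\<close> form a nonzero prime contained in \<open>P\<close>, and it equals \<open>P\<close> by the bound on the height.
\<close>

lemma serre_R1_A:
  assumes M: "\<not> prime_height (ring_on A) M \<le> 1"
  shows "serre_R1 (ring_on A)"
  unfolding serre_R1_def
proof (intro allI impI)
  fix P assume "primeideal P (ring_on A) \<and> prime_height (ring_on A) P \<le> 1"
  then have P: "primeideal P (ring_on A)" and height: "prime_height (ring_on A) P \<le> 1" by simp_all
  interpret P: primeideal P "ring_on A" by (rule P)
  have zero: "0 \<in> P" using additive_subgroup.zero_closed[OF P.additive_subgroup_axioms] by simp
  have PA: "P \<subseteq> A" using P.Icarr by auto
  have one: "1 \<notin> P" using P.one_imp_carrier P.I_notcarr by auto
  have mult: "x * y \<in> P" if "x \<in> P" "y \<in> A" for x y using P.I_r_closed[of x y] that by simp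
  have prime: "x \<in> P \<or> y \<in> P" if "x * y \<in> P" "x \<in> A" "y \<in> A" for x y
    using P.I_prime[of x y] that by simp
  show "regular_local_ring (localization (ring_on A) (carrier (ring_on A) - P))"
  proof (cases "P = {0}")
    case True
    then show ?thesis using regular_at_zero P by simp
  next
    case False
    have "P \<subseteq> M"
    proof
      fix x assume x: "x \<in> P"
      show "x \<in> M"
      proof (rule ccontr)
        assume "x \<notin> M"
        then have "x \<noteq> 0" "inverse x \<in> A" using unit_A[of x] x PA by auto
        then have "1 \<in> P" using mult[OF x, of "inverse x"] by simp
        with one show False ..
      qed
    qed
    moreover have "P \<noteq> M" using M height by blast
    ultimately obtain c where c: "c \<in> M" "c \<notin> P" by blast
    have cA: "c * x \<in> A" if "x \<in> B" for x
      using M_mult[OF c(1) that] M_sub_A by (auto simp: mult.commute)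
    have c_in: "c \<in> A" using c M_sub_A by blast
    have rearrange: "(c * Fract f 1) * (c * Fract f' g) = (c * Fract (f * f') g) * c" for f f' g
    proof -
      have "(c * Fract f 1) * (c * Fract f' g) = (c * (Fract f 1 * Fract f' g)) * c"
        by (simp only: mult_ac)
      then show ?thesis by simp
    qed
    have poly_B: "Fract f 1 \<in> B" for f using denominator_one by (auto intro: mem_B)
    obtain x where x: "x \<in> P" "x \<noteq> 0" using False zero by blast
    then have "x \<in> A" using PA by blast
    then obtain f0 g0 where f0: "f0 \<in> E" "g0 \<in> E" "g0 \<notin> I" "g0 \<noteq> 0" "x = Fract f0 g0" by (rule A_cases)
    have "Fract g0 1 \<in> A" using f0 denominator_one by (auto intro: mem_A)
    then have "x * Fract g0 1 \<in> P" using mult x by blast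
    moreover have "x * Fract g0 1 = Fract f0 1" using f0 by (simp add: eq_fract)
    ultimately have "Fract f0 1 * c \<in> P" using mult[of "Fract f0 1" c] c_in by simp
    then have start: "c * Fract f0 1 \<in> P" by (simp add: mult.commute)
    have "f0 \<noteq> 0" using x f0 by (auto simp: fract_collapse)
    \<comment> \<open>the factor \<open>c\<close> keeps the products in \<open>A\<close>, since factors of \<open>f\<close> need not lie in \<open>A\<close>\<close>
    have "f \<noteq> 0 \<longrightarrow> c * Fract f 1 \<in> P \<longrightarrow> (\<exists>q. prime_elem q \<and> c * Fract q 1 \<in> P)" for f
    proof (induction f rule: prime_divisors_induct)
      case (unit f)
      show ?case
      proof (intro impI)
        assume cf: "c * Fract f 1 \<in> P"
        obtain f' where "f * f' = 1" using unit by (metis dvdE)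
        then have eq: "(c * Fract f 1) * (c * Fract f' 1) = c * c"
          unfolding rearrange by (simp add: fract_collapse)
        have "c * c \<in> P" using mult[OF cf cA[OF poly_B[of f']]] unfolding eq .
        then show "\<exists>q. prime_elem q \<and> c * Fract q 1 \<in> P" using prime c_in c(2) by blast
      qed
    next
      case (factor p f)
      show ?case
      proof (intro impI)
        assume "p * f \<noteq> 0" and cf: "c * Fract (p * f) 1 \<in> P"
        have "(c * Fract p 1) * (c * Fract f 1) \<in> P" unfolding rearrange by (rule mult[OF cf c_in])
        then have "c * Fract p 1 \<in> P \<or> c * Fract f 1 \<in> P" using prime cA poly_B by blast
        then show "\<exists>q. prime_elem q \<and> c * Fract q 1 \<in> P"
          using factor \<open>p * f \<noteq> 0\<close> prime_imp_prime_elem by fastforce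
      qed
    qed simp
    then obtain q where q: "prime_elem q" "c * Fract q 1 \<in> P" using start \<open>f0 \<noteq> 0\<close> by blast
    have multiple: "x \<in> P" if x: "x \<in> A" "x = Fract (q * f) g" "g \<in> E - I" for x f g
    proof -
      have "Fract f g \<in> B" using x(3) by (auto intro: mem_B)
      then have "(c * Fract q 1) * (c * Fract f g) \<in> P" using mult[OF q(2) cA] by blast
      then have "(c * x) * c \<in> P" unfolding rearrange x(2) .
      moreover have "c * x \<in> A" using cA x(1) A_sub_B by blast
      ultimately show ?thesis using prime c_in c(2) x(1) by blast
    qed
    have not_dvd: "\<not> q dvd g" if g: "g \<in> E - I" for g
    proof
      assume "q dvd g"
      then obtain g' where "g = q * g'" by (rule dvdE)
      moreover have "Fract g 1 \<in> A" "Fract 1 g \<in> A"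
        using g E_one denominator_one by (auto intro: mem_A)
      ultimately have "Fract g 1 \<in> P" using multiple[of "Fract g 1" g' 1] denominator_one by simp
      then have "Fract g 1 * Fract 1 g \<in> P" using mult \<open>Fract 1 g \<in> A\<close> by blast
      moreover have "Fract g 1 * Fract 1 g = 1"
        using g denominator_nonzero by (simp add: One_fract_def eq_fract)
      ultimately show False using one by simp
    qed
    have sub: "divisible_by q \<subseteq> P"
    proof
      fix x assume "x \<in> divisible_by q"
      then obtain f g where "x \<in> A" "g \<in> E - I" "x = Fract (q * f) g"
        unfolding divisible_by_def by (auto elim: dvdE)
      then show "x \<in> P" using multiple by blast
    qed
    obtain c1 c2 where c12: "c1 \<in> I" "c2 \<in> E" "c2 \<notin> I" "c2 \<noteq> 0" "c = Fract c1 c2"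
      using c(1) by (rule M_cases)
    have "c * Fract q 1 \<in> divisible_by q"
      unfolding divisible_by_def
    proof (intro CollectI conjI exI)
      show "c * Fract q 1 \<in> A" by (rule cA[OF poly_B])
      show "c2 \<in> E - I" "q dvd c1 * q" "c * Fract q 1 = Fract (c1 * q) c2" using c12 by simp_all
    qed
    moreover have "c * Fract q 1 \<noteq> 0"
    proof -
      have "c \<noteq> 0" using c(2) zero by blast
      moreover have "Fract q 1 \<noteq> 0" using q(1) by (auto simp: Zero_fract_def eq_fract)
      ultimately show ?thesis by simp
    qed
    ultimately have "divisible_by q \<noteq> {0}" by blast
    then have "divisible_by q = P"
      using height_two[OF P prime_divisible_by[OF q(1) not_dvd]] sub height by blast
    then show ?thesis using regular_at_divisible_by[OF q(1) not_dvd c(1)] c(2) by simp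
  qed
qed

end

section \<open>A purely inseparable extension of residue fields\<close>

lemma two_dvd_iff: "(2 :: int poly) dvd f \<longleftrightarrow> (\<forall>i. even (poly.coeff f i))"
  using const_poly_dvd_iff[of 2 f] by (simp add: numeral_poly)

lemma prime_elem_two: "prime_elem (2 :: int poly)"
  using prime_elem_const_poly_iff[of "2::int"] by (simp add: numeral_poly)

text \<open>
  The polynomials whose reduction modulo 2 lies in \<open>\<FF>\<^sub>2[X\<^sup>2]\<close>, and the ideal \<open>(2)\<close>.
\<close>

definition inseparable_E :: "int poly set" where
  "inseparable_E = {f. \<forall>i. odd i \<longrightarrow> even (poly.coeff f i)}"

definition inseparable_I :: "int poly set" where
  "inseparable_I = {f. 2 dvd f}"

text \<open>
  Modulo 2 this is the Frobenius map. In the coefficient of an odd power of \<open>X\<close> the products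
  occur in equal pairs, since exchanging the two factors fixes none of them.
\<close>

lemma square_in_inseparable_E: "f * f \<in> inseparable_E"
proof -
  have "even (poly.coeff (f * f) (2 * k + 1))" for k
  proof -
    define c where "c i = poly.coeff f i * poly.coeff f (2 * k + 1 - i)" for i
    have "poly.coeff (f * f) (2 * k + 1) = sum c {..2 * k + 1}"
      by (simp add: coeff_mult c_def)
    also have "{..2 * k + 1} = {..k} \<union> {k + 1..2 * k + 1}" by auto
    also have "sum c \<dots> = sum c {..k} + sum c {k + 1..2 * k + 1}"
      by (rule sum.union_disjoint) auto
    also have "sum c {k + 1..2 * k + 1} = sum c {..k}"
      by (rule sum.reindex_bij_witness[of _ "\<lambda>i. 2 * k + 1 - i" "\<lambda>i. 2 * k + 1 - i"])
        (auto simp: c_def)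
    finally show ?thesis by simp
  qed
  then show ?thesis unfolding inseparable_E_def by (auto elim!: oddE)
qed

interpretation inseparable: conductor_square inseparable_E inseparable_I
proof
  show "1 \<in> inseparable_E" by (auto simp: inseparable_E_def)
  show "f + g \<in> inseparable_E" if "f \<in> inseparable_E" "g \<in> inseparable_E" for f g
    using that by (simp add: inseparable_E_def)
  show "- f \<in> inseparable_E" if "f \<in> inseparable_E" for f
    using that by (simp add: inseparable_E_def)
  show "f * g \<in> inseparable_E" if fg: "f \<in> inseparable_E" "g \<in> inseparable_E" for f g
    unfolding inseparable_E_def
  proof (intro CollectI allI impI)
    fix n :: nat assume "odd n"
    have "even (poly.coeff f i * poly.coeff g (n - i))" if "i \<le> n" for i
    proof -
      have "odd i \<or> odd (n - i)" using that \<open>odd n\<close> by simp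
      then have "even (poly.coeff f i) \<or> even (poly.coeff g (n - i))"
        using fg unfolding inseparable_E_def by blast
      then show ?thesis by simp
    qed
    then show "even (poly.coeff (f * g) n)"
      unfolding coeff_mult by (intro dvd_sum) simp
  qed
  show "inseparable_I \<subseteq> inseparable_E" by (auto simp: inseparable_I_def inseparable_E_def two_dvd_iff)
  show "f + g \<in> inseparable_I" if "f \<in> inseparable_I" "g \<in> inseparable_I" for f g
    using that by (simp add: inseparable_I_def)
  show "g * f \<in> inseparable_I" if "f \<in> inseparable_I" for f g
    using that by (simp add: inseparable_I_def)
  show "1 \<notin> inseparable_I"
    using prime_elem_not_unit[OF prime_elem_two] by (simp add: inseparable_I_def)
  show "f \<in> inseparable_I \<or> g \<in> inseparable_I" if "f * g \<in> inseparable_I" for f g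
    using that prime_elem_two prime_elem_dvd_mult_iff unfolding inseparable_I_def by blast
  show "2 \<in> inseparable_I" by (simp add: inseparable_I_def)
  show "\<exists>r\<in>inseparable_E. f * f - r * f \<in> inseparable_E" for f
    using square_in_inseparable_E[of f] by (intro bexI[of _ 0]) (simp_all add: inseparable_E_def)
  show "\<exists>Y\<in>inseparable_E. Polynomial.lead_coeff Y = 1 \<and> Polynomial.degree Y > 0"
    using square_in_inseparable_E[of "[:0, 1:]"] by (intro bexI[of _ "[:0, 1:] * [:0, 1:]"]) simp_all
qed

text \<open>Here \<open>B\<close> is a discrete valuation ring, and \<open>M\<close> is its maximal ideal. The square of a
  numerator outside \<open>(2)\<close> serves as a denominator.\<close>

lemma inseparable_radical:
  assumes "x \<in> inseparable.B" "x \<notin> inseparable.M"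
  shows "\<exists>J. maximal_in inseparable.B J \<and> x \<notin> J"
proof (intro exI conjI)
  show "maximal_in inseparable.B inseparable.M"
    unfolding maximal_in_def
  proof (intro conjI ballI impI inseparable.zero_in_M inseparable.one_notin_M)
    show "inseparable.M \<subseteq> inseparable.B" using inseparable.M_sub_A inseparable.A_sub_B by blast
    show "x + y \<in> inseparable.M" if "x \<in> inseparable.M" "y \<in> inseparable.M" for x y
      using that by (rule inseparable.M_add)
    show "y * x \<in> inseparable.M" if "x \<in> inseparable.M" "y \<in> inseparable.B" for x y
      using that by (rule inseparable.M_mult)
    fix x assume "x \<in> inseparable.B" "x \<notin> inseparable.M"
    then obtain f g where f: "g \<in> inseparable_E" "g \<notin> inseparable_I" "g \<noteq> 0" "x = Fract f g"
      by (elim inseparable.B_cases)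
    then have "f \<notin> inseparable_I" using inseparable.mem_M \<open>x \<notin> inseparable.M\<close> by blast
    then have "f * f \<notin> inseparable_I"
      using prime_elem_two prime_elem_dvd_mult_iff unfolding inseparable_I_def by blast
    then have "Fract (g * f) (f * f) \<in> inseparable.B"
      using square_in_inseparable_E by (intro inseparable.mem_B)
    moreover have "f \<noteq> 0" using \<open>f \<notin> inseparable_I\<close> inseparable.zero_in_I by blast
    then have "1 - x * Fract (g * f) (f * f) = 0"
      using f by (simp add: One_fract_def eq_fract fract_collapse(1))
    ultimately show "\<exists>y\<in>inseparable.B. 1 - x * y \<in> inseparable.M" using inseparable.zero_in_M by metis
  qed
qed (rule assms(2))

lemma inseparable_not_weakly_normal: "\<not> weakly_normal (ring_on inseparable.A)"
proof (rule inseparable.not_weakly_normal_A)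
  show "Fract [:0, 1:] 1 \<in> inseparable.B" using inseparable.denominator_one by (auto intro: inseparable.mem_B)
  have "Fract ([:0, 1:] * [:0, 1:]) 1 \<in> inseparable.A"
    using inseparable.denominator_one square_in_inseparable_E[of "[:0, 1:]"] by (intro inseparable.mem_A) simp_all
  then show "Fract [:0, 1:] 1 ^ 2 \<in> inseparable.A" by (simp add: power2_eq_square)
  show "Fract [:0, 1:] 1 \<notin> inseparable.A"
  proof
    assume "Fract [:0, 1:] 1 \<in> inseparable.A"
    then obtain f g where f: "f \<in> inseparable_E" "g \<in> inseparable_E" "g \<notin> inseparable_I" "g \<noteq> 0"
      "Fract [:0, 1:] 1 = Fract f g" by (rule inseparable.A_cases)
    then have "f = pCons 0 g" by (simp add: eq_fract)
    then have "even (poly.coeff g i)" for i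
      using f(1,2) by (cases "even i") (auto simp: inseparable_E_def dest: spec[of _ "Suc i"])
    then show False using f(3) by (simp add: inseparable_I_def two_dvd_iff)
  qed
qed

section \<open>Two closed points glued together\<close>

text \<open>
  The values in \<open>\<FF>\<^sub>2\<close> at the points \<open>(2, X)\<close> and \<open>(2, X - 1)\<close> are the parities of the values at 0 and 1.
\<close>

definition glued_E :: "int poly set" where
  "glued_E = {f. even (poly f 0) \<longleftrightarrow> even (poly f 1)}"

definition glued_I :: "int poly set" where
  "glued_I = {f. even (poly f 0) \<and> even (poly f 1)}"

lemma glued_denominator: "g \<in> glued_E - glued_I \<longleftrightarrow> odd (poly g 0) \<and> odd (poly g 1)"
  by (auto simp: glued_E_def glued_I_def)

interpretation glued: conductor_square glued_E glued_I
proof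
  show "\<exists>r\<in>glued_E. f * f - r * f \<in> glued_E" for f
    by (intro bexI[of _ 1]) (simp_all add: glued_E_def)
  show "\<exists>Y\<in>glued_E. Polynomial.lead_coeff Y = 1 \<and> Polynomial.degree Y > 0"
    \<comment> \<open>\<open>X\<^sup>2 - X\<close> vanishes at both points\<close>
    by (intro bexI[of _ "[:0, -1, 1:]"]) (simp_all add: glued_E_def)
  show "f * g \<in> glued_E" if "f \<in> glued_E" "g \<in> glued_E" for f g
    using that unfolding glued_E_def by simp
  show "f \<in> glued_I \<or> g \<in> glued_I" if "f \<in> glued_E" "g \<in> glued_E" "f * g \<in> glued_I" for f g
    using that unfolding glued_E_def glued_I_def by auto
qed (simp_all add: glued_E_def glued_I_def subset_iff)

text \<open>An element of \<open>B\<close> outside \<open>M\<close> is nonzero at one of the two points \<open>a\<close>, and thus avoids the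
  maximal ideal \<open>J\<close> of that point.\<close>

lemma glued_radical:
  assumes "x \<in> glued.B" "x \<notin> glued.M"
  shows "\<exists>J. maximal_in glued.B J \<and> x \<notin> J"
proof -
  obtain f g where x: "g \<in> glued_E" "g \<notin> glued_I" "g \<noteq> 0" "x = Fract f g"
    using assms(1) by (rule glued.B_cases)
  then have "f \<notin> glued_I" using assms(2) glued.mem_M by blast
  then obtain a where a: "a = 0 \<or> a = 1" "odd (poly f a)" unfolding glued_I_def by blast
  define J where "J = {Fract f g | f g. even (poly f a) \<and> g \<in> glued_E - glued_I}"
  have odd_g: "odd (poly g a)" if "g \<in> glued_E - glued_I" for g
    using that a(1) glued_denominator by blast
  have J_iff: "Fract f g \<in> J \<longleftrightarrow> even (poly f a)" if g: "g \<in> glued_E - glued_I" for f g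
  proof
    assume "Fract f g \<in> J"
    then obtain f' g' where f': "even (poly f' a)" "g' \<in> glued_E - glued_I" "Fract f g = Fract f' g'"
      unfolding J_def by blast
    then have "f * g' = f' * g"
      using g glued.denominator_nonzero[of g] glued.denominator_nonzero[of g'] by (simp add: eq_fract)
    then have "poly f a * poly g' a = poly f' a * poly g a" by (metis poly_mult)
    moreover have "even (poly f' a * poly g a)" using f'(1) by simp
    ultimately have "even (poly f a * poly g' a)" by simp
    then show "even (poly f a)" using odd_g[OF f'(2)] by simp
  qed (use g in \<open>auto simp: J_def\<close>)
  have B_cases: "\<exists>f g. g \<in> glued_E - glued_I \<and> g \<noteq> 0 \<and> z = Fract f g" if "z \<in> glued.B" for z
    using that by (elim glued.B_cases) blast
  have "J \<subseteq> glued.B" unfolding J_def glued.B_def by blast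
  have "maximal_in glued.B J"
    unfolding maximal_in_def
  proof (intro conjI ballI impI \<open>J \<subseteq> glued.B\<close>)
    show "0 \<in> J" "1 \<notin> J"
      using J_iff[OF glued.denominator_one, of 0] J_iff[OF glued.denominator_one, of 1]
      by (simp_all add: fract_collapse)
    fix y assume y: "y \<in> J"
    then obtain f g where f: "g \<in> glued_E - glued_I" "g \<noteq> 0" "y = Fract f g"
      using B_cases \<open>J \<subseteq> glued.B\<close> by blast
    show "y + z \<in> J" if z: "z \<in> J" for z
    proof -
      obtain f' g' where f': "g' \<in> glued_E - glued_I" "g' \<noteq> 0" "z = Fract f' g'"
        using B_cases z \<open>J \<subseteq> glued.B\<close> by blast
      have "even (poly f a)" "even (poly f' a)" using J_iff f f' y z by auto
      then show ?thesis
        using f f' J_iff[OF glued.denominator_mult[OF f(1) f'(1)]] by simp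
    qed
    show "z * y \<in> J" if z: "z \<in> glued.B" for z
    proof -
      obtain f' g' where f': "g' \<in> glued_E - glued_I" "g' \<noteq> 0" "z = Fract f' g'"
        using B_cases z by blast
      have "even (poly f a)" using J_iff f y by auto
      then show ?thesis
        using f f' J_iff[OF glued.denominator_mult[OF f'(1) f(1)]] by simp
    qed
  next
    fix y assume y: "y \<in> glued.B" "y \<notin> J"
    then obtain f g where f: "g \<in> glued_E - glued_I" "g \<noteq> 0" "y = Fract f g" using B_cases by blast
    then have "odd (poly f a)" using J_iff y by blast
    moreover have "1 - y * 1 = Fract (g - f) g" using f by (simp add: One_fract_def)
    ultimately have "1 - y * 1 \<in> J" using J_iff[OF f(1), of "g - f"] odd_g[OF f(1)] by simp
    moreover have "1 \<in> glued.B" using glued.subring_B by (simp add: unital_subring_def)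
    ultimately show "\<exists>z\<in>glued.B. 1 - y * z \<in> J" by blast
  qed
  moreover have "x \<notin> J" using J_iff x a(2) by auto
  ultimately show ?thesis by blast
qed

text \<open>Both values in \<open>\<FF>\<^sub>2\<close> are unchanged by taking powers.\<close>

lemma glued_root:
  assumes b: "b \<in> glued.B" "b ^ (2 ^ n) \<in> glued.A"
  shows "b \<in> glued.A"
proof -
  obtain f g where f: "g \<in> glued_E" "g \<notin> glued_I" "g \<noteq> 0" "b = Fract f g"
    using b(1) by (rule glued.B_cases)
  define k :: nat where "k = 2 ^ n"
  have "k > 0" by (simp add: k_def)
  have "Fract (f ^ k) (g ^ k) \<in> glued.A" using b(2) f(4) by (simp add: Fract_power k_def)
  then obtain f' g' where f': "f' \<in> glued_E" "g' \<in> glued_E" "g' \<notin> glued_I" "g' \<noteq> 0"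
    "Fract (f ^ k) (g ^ k) = Fract f' g'" by (rule glued.A_cases)
  then have eq: "f ^ k * g' = f' * g ^ k" using f(3) by (simp add: eq_fract)
  have "even (poly f a) \<longleftrightarrow> even (poly f' a)" if a: "a = 0 \<or> a = 1" for a
  proof -
    have odd: "odd (poly g a)" "odd (poly g' a)"
      using f f' a glued_denominator by blast+
    have "poly f a ^ k * poly g' a = poly f' a * poly g a ^ k"
      using arg_cong[OF eq, of "\<lambda>p. poly p a"] by simp
    then have "even (poly f a ^ k * poly g' a) \<longleftrightarrow> even (poly f' a * poly g a ^ k)" by simp
    then show ?thesis using odd \<open>k > 0\<close> by simp
  qed
  then have "f \<in> glued_E" using f'(1) by (simp add: glued_E_def)
  then show ?thesis using f glued.mem_A by blast
qed

lemma glued_not_normal: "\<not> is_normal (ring_on glued.A)"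
proof -
  have "Fract [:0, 1:] 1 \<in> glued.B" using glued.denominator_one by (auto intro: glued.mem_B)
  moreover have "Fract [:0, 1:] 1 \<notin> glued.A"
  proof
    assume "Fract [:0, 1:] 1 \<in> glued.A"
    then obtain f g where f: "f \<in> glued_E" "g \<in> glued_E" "g \<notin> glued_I" "g \<noteq> 0"
      "Fract [:0, 1:] 1 = Fract f g" by (rule glued.A_cases)
    then have "f = pCons 0 g" by (simp add: eq_fract)
    moreover have "odd (poly g 1)" using f glued_denominator by blast
    ultimately show False using f(1) by (simp add: glued_E_def)
  qed
  ultimately show ?thesis using glued.is_normal_iff by blast
qed

text \<open>The multiples of 2 form a nonzero prime, and \<open>X\<^sup>2 - X\<close> lies in \<open>M\<close> but is not a multiple of 2.\<close>

lemma glued_height: "\<not> prime_height (ring_on glued.A) glued.M \<le> 1"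
proof (rule glued.height_two)
  have not_dvd: "\<not> 2 dvd g" if "g \<in> glued_E - glued_I" for g
    using that glued_denominator by (auto elim!: dvdE)
  have iff: "Fract f 1 \<in> glued.divisible_by 2 \<longleftrightarrow> 2 dvd f" if "Fract f 1 \<in> glued.A" for f
    by (rule glued.Fract_divisible_iff[OF prime_elem_two _ glued.denominator_one that]) (rule not_dvd)
  show "primeideal glued.M (ring_on glued.A)"
    by (rule glued.A.maximalideal_prime[OF glued.maximal_M])
  show "primeideal (glued.divisible_by 2) (ring_on glued.A)"
    by (rule glued.prime_divisible_by[OF prime_elem_two not_dvd])
  have "glued.divisible_by 2 \<subseteq> glued.M"
  proof
    fix x assume "x \<in> glued.divisible_by 2"
    then obtain f g where x: "2 dvd f" "g \<in> glued_E - glued_I" "x = Fract f g"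
      unfolding glued.divisible_by_def by blast
    from x(1) obtain k where "f = 2 * k" by (rule dvdE)
    then have "f \<in> glued_I" by (simp add: glued_I_def)
    with x show "x \<in> glued.M" using glued.mem_M by blast
  qed
  moreover have in_M: "Fract [:0, -1, 1:] 1 \<in> glued.M"
    using glued.denominator_one by (intro glued.mem_M) (auto simp: glued_I_def)
  moreover have "\<not> 2 dvd [:0, -1, 1 :: int:]"
    unfolding two_dvd_iff by (auto intro!: exI[of _ "1::nat"])
  then have "Fract [:0, -1, 1:] 1 \<notin> glued.divisible_by 2"
    using iff[of "[:0, -1, 1:]"] in_M glued.M_sub_A by blast
  ultimately show "glued.divisible_by 2 \<subset> glued.M" by blast
  have "Fract 2 1 \<in> glued.A"
    using glued.mem_A[of 2 1] glued.two_in_I glued.I_sub glued.denominator_one by blast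
  then have "Fract 2 1 \<in> glued.divisible_by 2"
    using iff[of 2] by simp
  moreover have "Fract (2 :: int poly) 1 \<noteq> 0" by (simp add: Zero_fract_def eq_fract)
  ultimately show "glued.divisible_by 2 \<noteq> {0}" by blast
qed

theorem theorem2:
  shows "(\<exists>(R :: int poly fract ring) m.
            local_ring R m \<and> noetherian_domain R \<and> mixed_characteristic R m \<and>
            seminormal R \<and> \<not> weakly_normal R) \<and>
         (\<exists>(R :: int poly fract ring) m.
            local_ring R m \<and> noetherian_domain R \<and> mixed_characteristic R m \<and>
            weakly_normal R \<and> serre_R1 R \<and> \<not> is_normal R)"
proof (intro conjI exI)
  show "local_ring (ring_on inseparable.A) inseparable.M" by (rule inseparable.local_ring_A)
  show "noetherian_domain (ring_on inseparable.A)" by (rule inseparable.noetherian_A)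
  show "mixed_characteristic (ring_on inseparable.A) inseparable.M" by (rule inseparable.mixed_characteristic_A)
  show "seminormal (ring_on inseparable.A)" by (rule inseparable.seminormal_A[OF inseparable_radical])
  show "\<not> weakly_normal (ring_on inseparable.A)" by (rule inseparable_not_weakly_normal)
  show "local_ring (ring_on glued.A) glued.M" by (rule glued.local_ring_A)
  show "noetherian_domain (ring_on glued.A)" by (rule glued.noetherian_A)
  show "mixed_characteristic (ring_on glued.A) glued.M" by (rule glued.mixed_characteristic_A)
  show "weakly_normal (ring_on glued.A)" by (rule glued.weakly_normal_A[OF glued_radical glued_root])
  show "serre_R1 (ring_on glued.A)" by (rule glued.serre_R1_A[OF glued_height])
  show "\<not> is_normal (ring_on glued.A)" by (rule glued_not_normal)
qed

end
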